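(* Let $\mathcal{H}$ be a family of graphs. There is a constant $C=C(\mathcal{H})$ such that $$\#\{v\in V(G):\alpha(N(v))\ge 2\}\le C$$ for every connected $\mathcal{H}$-free graph $G$ if and only if $$\mathcal{H}\le \{K_n^*,\ P_n,\ K_{1,n}^*,\ K_{2,n},\ E_2+K_n,\ K_1+nP_3,\ CK_n\}$$ for some positive integer $n$.
   Context: All graphs are finite, undirected and simple. For graphs $H_1,H_2$, write $H_1\le H_2$ if $H_1$ is (isomorphic to) an induced subgraph of $H_2$. A graph $G$ is $\mathcal{H}$-free if there is no $H\in\mathcal{H}$ with $H\le G$. For families of graphs $\mathcal{H}_1,\mathcal{H}_2$, write $\mathcal{H}_1\le\mathcal{H}_2$ if for every $H_2\in\mathcal{H}_2$ there is $H_1\in\mathcal{H}_1$ with $H_1\le H_2$. $N(v)$ is the set of vertices of $G$ adjacent to $v$, and for $S\subset V(G)$, $\alpha(S)$ is the independence number of the induced subgraph $G[S]$. $K_n$ is the complete graph and $E_n$ the edgeless graph on $n$ vertices, $P_n$ the path on $n$ vertices, $K_{s,t}$ the complete bipartite graph. $G_1+G_2$ denotes the join of $G_1$ and $G_2$: the graph with vertex set $V(G_1)\sqcup V(G_2)$ whose edges are those of $G_1$, those of $G_2$, and all pairs $\{x,y\}$ with $x\in V(G_1)$, $y\in V(G_2)$. $nG$ denotes the disjoint union of $n$ copies of $G$ (in $G_1+nG_2$ this is formed before the join). $K_{1,n}^*$ is obtained from the star $K_{1,n}$ by attaching one pendant vertex to each of its $n$ leaves. $K_n^*$ is obtained from $K_n$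 by attaching one pendant vertex to every vertex of $K_n$. $CK_n$ is obtained from two disjoint copies of $K_n$ by adding a perfect matching between them. *)

theory Defs
  imports "Graph_Theory.Graph_Theory" "HOL-Library.Nat_Bijection"
begin

text \<open>
  A finite simple graph is a \<^typ>\<open>'a pair_pre_digraph\<close> satisfying \<^locale>\<open>pair_graph\<close>, i.e. a
  finite vertex set with a symmetric irreflexive set of arcs; an edge is a pair of opposite arcs.
  The null graph is a \<^locale>\<open>pair_graph\<close>, but it is not connected.
\<close>

section \<open>Induced subgraphs, neighbourhoods, independence number\<close>

definition induced_le :: "'a pair_pre_digraph \<Rightarrow> 'b pair_pre_digraph \<Rightarrow> bool"
    (infix \<open>\<le>\<^sub>i\<^sub>n\<^sub>d\<close> 50) where
  "H1 \<le>\<^sub>i\<^sub>n\<^sub>d H2 \<longleftrightarrow>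
    (\<exists>K. induced_subgraph K (with_proj H2) \<and> digraph_iso (with_proj H1) K)"

definition family_le :: "'a pair_pre_digraph set \<Rightarrow> 'b pair_pre_digraph set \<Rightarrow> bool"
    (infix \<open>\<le>\<^sub>f\<^sub>a\<^sub>m\<close> 50) where
  "\<H>1 \<le>\<^sub>f\<^sub>a\<^sub>m \<H>2 \<longleftrightarrow> (\<forall>H2\<in>\<H>2. \<exists>H1\<in>\<H>1. H1 \<le>\<^sub>i\<^sub>n\<^sub>d H2)"

definition family_free :: "'a pair_pre_digraph set \<Rightarrow> 'b pair_pre_digraph \<Rightarrow> bool" where
  "family_free \<H> G \<longleftrightarrow> \<not> (\<exists>H\<in>\<H>. H \<le>\<^sub>i\<^sub>n\<^sub>d G)"

definition neighbourhood :: "'a pair_pre_digraph \<Rightarrow> 'a \<Rightarrow> 'a set" where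
  "neighbourhood G v = {u. (v, u) \<in> parcs G}"

definition independent :: "('a, 'b) pre_digraph \<Rightarrow> 'a set \<Rightarrow> bool" where
  "independent G I \<longleftrightarrow> I \<subseteq> verts G \<and> (\<forall>u\<in>I. \<forall>v\<in>I. \<not> u \<rightarrow>\<^bsub>G\<^esub> v)"

text \<open>Meaningful for finite graphs only, where the maximum is over a finite nonempty set.\<close>

definition independence_number :: "('a, 'b) pre_digraph \<Rightarrow> nat" where
  "independence_number G = Max (card ` {I. independent G I})"

definition \<alpha> :: "'a pair_pre_digraph \<Rightarrow> 'a set \<Rightarrow> nat" where
  "\<alpha> G S = independence_number (with_proj G \<restriction> S)"


section \<open>Graph constructions\<close>

text \<open>
  All constructions produce graphs on natural numbers, so that graphs of different shapes can be
  members of one family. Disjoint unions of vertex sets are encoded by \<^const>\<open>sum_encode\<close>, and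
  vertex \<^term>\<open>v\<close> of the \<^term>\<open>i\<close>-th of several copies by \<^term>\<open>prod_encode (i, v)\<close>.
\<close>

abbreviation inl :: "nat \<Rightarrow> nat" where "inl x \<equiv> sum_encode (Inl x)"
abbreviation inr :: "nat \<Rightarrow> nat" where "inr x \<equiv> sum_encode (Inr x)"

definition complete_graph :: "nat \<Rightarrow> nat pair_pre_digraph" where
  "complete_graph n = \<lparr>pverts = {..<n}, parcs = {(i, j). i < n \<and> j < n \<and> i \<noteq> j}\<rparr>"

definition edgeless_graph :: "nat \<Rightarrow> nat pair_pre_digraph" where
  "edgeless_graph n = \<lparr>pverts = {..<n}, parcs = {}\<rparr>"

definition path_graph :: "nat \<Rightarrow> nat pair_pre_digraph" where
  "path_graph n =
    \<lparr>pverts = {..<n}, parcs = {(i, j). i < n \<and> j < n \<and> (j = Suc i \<or> i = Suc j)}\<rparr>"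

definition join :: "nat pair_pre_digraph \<Rightarrow> nat pair_pre_digraph \<Rightarrow> nat pair_pre_digraph" where
  "join G1 G2 =
    \<lparr>pverts = inl ` pverts G1 \<union> inr ` pverts G2,
     parcs = map_prod inl inl ` parcs G1 \<union> map_prod inr inr ` parcs G2
       \<union> (inl ` pverts G1) \<times> (inr ` pverts G2) \<union> (inr ` pverts G2) \<times> (inl ` pverts G1)\<rparr>"

definition copies :: "nat \<Rightarrow> nat pair_pre_digraph \<Rightarrow> nat pair_pre_digraph" where
  "copies n G =
    \<lparr>pverts = {prod_encode (i, v) | i v. i < n \<and> v \<in> pverts G},
     parcs = {(prod_encode (i, u), prod_encode (i, v)) | i u v. i < n \<and> (u, v) \<in> parcs G}\<rparr>"

text \<open>One new vertex \<^term>\<open>inr s\<close> is attached to every vertex \<^term>\<open>s\<close> in \<^term>\<open>S\<close>.\<close>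

definition attach_pendants :: "nat pair_pre_digraph \<Rightarrow> nat set \<Rightarrow> nat pair_pre_digraph" where
  "attach_pendants G S =
    \<lparr>pverts = inl ` pverts G \<union> inr ` S,
     parcs = map_prod inl inl ` parcs G
       \<union> {(inl s, inr s) | s. s \<in> S} \<union> {(inr s, inl s) | s. s \<in> S}\<rparr>"

definition complete_bipartite_graph :: "nat \<Rightarrow> nat \<Rightarrow> nat pair_pre_digraph" where
  "complete_bipartite_graph s t = join (edgeless_graph s) (edgeless_graph t)"

text \<open>\<open>K\<^sub>n\<^sup>*\<close>\<close>

definition pendant_complete_graph :: "nat \<Rightarrow> nat pair_pre_digraph" where
  "pendant_complete_graph n = attach_pendants (complete_graph n) (pverts (complete_graph n))"

text \<open>\<open>K\<^sub>1\<^sub>,\<^sub>n\<^sup>*\<close>; the leaves of \<open>K\<^sub>1\<^sub>,\<^sub>n\<close> are the vertices on its right-hand side.\<close>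

definition pendant_star :: "nat \<Rightarrow> nat pair_pre_digraph" where
  "pendant_star n = attach_pendants (complete_bipartite_graph 1 n) (inr ` {..<n})"

text \<open>\<open>CK\<^sub>n\<close>\<close>

definition matched_complete_graphs :: "nat \<Rightarrow> nat pair_pre_digraph" where
  "matched_complete_graphs n =
    \<lparr>pverts = pverts (copies 2 (complete_graph n)),
     parcs = parcs (copies 2 (complete_graph n))
       \<union> {(prod_encode (0, v), prod_encode (1, v)) | v. v < n}
       \<union> {(prod_encode (1, v), prod_encode (0, v)) | v. v < n}\<rparr>"


section \<open>Well-formedness\<close>

lemma pair_graph_iff:
  "pair_graph G \<longleftrightarrow> finite (pverts G) \<and> parcs G \<subseteq> pverts G \<times> pverts G \<and> sym (parcs G) \<and> irrefl (parcs G)"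
proof
  assume "pair_graph G"
  then interpret pair_graph G .
  show "finite (pverts G) \<and> parcs G \<subseteq> pverts G \<times> pverts G \<and> sym (parcs G) \<and> irrefl (parcs G)"
  proof (intro conjI)
    show "parcs G \<subseteq> pverts G \<times> pverts G" using in_arcsD1 in_arcsD2 by auto
    show "sym (parcs G)" using pair_sym_arcs by (simp add: symmetric_def)
    show "irrefl (parcs G)" unfolding irrefl_def using pair_no_loops by fastforce
  qed (rule pair_finite_verts)
next
  assume A: "finite (pverts G) \<and> parcs G \<subseteq> pverts G \<times> pverts G \<and> sym (parcs G) \<and> irrefl (parcs G)"
  then have "finite (parcs G)" by (meson finite_SigmaI finite_subset)
  with A show "pair_graph G"
    by unfold_locales (auto simp: symmetric_def irrefl_def)
qed

lemma induced_le_iff: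
  assumes "pair_graph H1" "pair_graph H2"
  shows "H1 \<le>\<^sub>i\<^sub>n\<^sub>d H2 \<longleftrightarrow>
    (\<exists>f. inj_on f (pverts H1) \<and> f ` pverts H1 \<subseteq> pverts H2 \<and>
      (\<forall>u\<in>pverts H1. \<forall>v\<in>pverts H1. (u, v) \<in> parcs H1 \<longleftrightarrow> (f u, f v) \<in> parcs H2))"
proof -
  interpret H1: pair_graph H1 by fact
  interpret H2: pair_graph H2 by fact
  show ?thesis
  proof
    assume "H1 \<le>\<^sub>i\<^sub>n\<^sub>d H2"
    then obtain K hom where K: "induced_subgraph K (with_proj H2)"
      and hom: "pre_digraph.digraph_isomorphism (with_proj H1) hom"
      and K_eq: "K = app_iso hom (with_proj H1)"
      unfolding induced_le_def digraph_iso_def by blast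
    let ?f = "iso_verts hom"
    have inj: "inj_on ?f (pverts H1)"
      and ends: "\<And>a. a \<in> parcs H1 \<Longrightarrow>
        ?f (fst a) = iso_tail hom (iso_arcs hom a) \<and> ?f (snd a) = iso_head hom (iso_arcs hom a)"
      using hom unfolding pre_digraph.digraph_isomorphism_def by auto
    have tl: "iso_tail hom = fst" and hd: "iso_head hom = snd"
      and sub: "?f ` pverts H1 \<subseteq> pverts H2"
      and arcs: "iso_arcs hom ` parcs H1
        = {e \<in> parcs H2. fst e \<in> ?f ` pverts H1 \<and> snd e \<in> ?f ` pverts H1}"
      using K unfolding induced_subgraph_def subgraph_def compatible_def K_eq by auto
    have arc: "iso_arcs hom a = (?f (fst a), ?f (snd a))" if "a \<in> parcs H1" for a
      using ends[OF that] tl hd by (simp add: prod_eq_iff)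
    have "(u, v) \<in> parcs H1 \<longleftrightarrow> (?f u, ?f v) \<in> parcs H2"
      if u: "u \<in> pverts H1" and v: "v \<in> pverts H1" for u v
    proof
      assume "(u, v) \<in> parcs H1"
      then have "iso_arcs hom (u, v) \<in> parcs H2" using arcs by blast
      then show "(?f u, ?f v) \<in> parcs H2" using arc[OF \<open>(u, v) \<in> parcs H1\<close>] by simp
    next
      assume "(?f u, ?f v) \<in> parcs H2"
      then have "(?f u, ?f v) \<in> iso_arcs hom ` parcs H1" using arcs u v by auto
      then obtain a where a: "a \<in> parcs H1" "iso_arcs hom a = (?f u, ?f v)" by auto
      then have "?f (fst a) = ?f u" "?f (snd a) = ?f v" using arc by auto
      moreover have "fst a \<in> pverts H1" "snd a \<in> pverts H1"
        using a H1.arc_fst_in_verts H1.arc_snd_in_verts by auto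
      ultimately have "a = (u, v)" using inj u v by (auto simp: prod_eq_iff dest: inj_onD)
      then show "(u, v) \<in> parcs H1" using a by simp
    qed
    then show "\<exists>f. inj_on f (pverts H1) \<and> f ` pverts H1 \<subseteq> pverts H2 \<and>
      (\<forall>u\<in>pverts H1. \<forall>v\<in>pverts H1. (u, v) \<in> parcs H1 \<longleftrightarrow> (f u, f v) \<in> parcs H2)"
      using inj sub by blast
  next
    assume "\<exists>f. inj_on f (pverts H1) \<and> f ` pverts H1 \<subseteq> pverts H2 \<and>
      (\<forall>u\<in>pverts H1. \<forall>v\<in>pverts H1. (u, v) \<in> parcs H1 \<longleftrightarrow> (f u, f v) \<in> parcs H2)"
    then obtain f where inj: "inj_on f (pverts H1)" and sub: "f ` pverts H1 \<subseteq> pverts H2"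
      and edge: "\<And>u v. u \<in> pverts H1 \<Longrightarrow> v \<in> pverts H1 \<Longrightarrow>
        (u, v) \<in> parcs H1 \<longleftrightarrow> (f u, f v) \<in> parcs H2" by blast
    define hom where "hom = \<lparr>iso_verts = f, iso_arcs = map_prod f f,
      iso_head = (snd :: 'b \<times> 'b \<Rightarrow> 'b), iso_tail = fst\<rparr>"
    have "inj_on (map_prod f f) (parcs H1)"
      using map_prod_inj_on[OF inj inj] by (rule inj_on_subset) (auto dest: H1.in_arcsD1 H1.in_arcsD2)
    then have "pre_digraph.digraph_isomorphism (with_proj H1) hom"
      using inj H1.wf_digraph_axioms unfolding pre_digraph.digraph_isomorphism_def hom_def
      by (auto simp: fst_map_prod snd_map_prod)
    moreover have "app_iso hom (with_proj H1) = with_proj H2 \<restriction> (f ` pverts H1)"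
    proof -
      have "map_prod f f ` parcs H1
        = {e \<in> parcs H2. fst e \<in> f ` pverts H1 \<and> snd e \<in> f ` pverts H1}"
      proof (intro set_eqI iffI)
        fix e assume "e \<in> map_prod f f ` parcs H1"
        then obtain u v where e: "e = (f u, f v)" and uv: "(u, v) \<in> parcs H1" by auto
        then have "u \<in> pverts H1" "v \<in> pverts H1" using H1.in_arcsD1 H1.in_arcsD2 by auto
        then show "e \<in> {e \<in> parcs H2. fst e \<in> f ` pverts H1 \<and> snd e \<in> f ` pverts H1}"
          using e uv edge by auto
      next
        fix e assume "e \<in> {e \<in> parcs H2. fst e \<in> f ` pverts H1 \<and> snd e \<in> f ` pverts H1}"
        then obtain u v where "u \<in> pverts H1" "v \<in> pverts H1" "fst e = f u" "snd e = f v"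
          "e \<in> parcs H2" by auto
        then have "e = map_prod f f (u, v)" "(u, v) \<in> parcs H1"
          using edge[of u v] by (auto simp: prod_eq_iff) (metis prod.collapse)
        then show "e \<in> map_prod f f ` parcs H1" by blast
      qed
      then show ?thesis by (auto simp: app_iso_def induce_subgraph_def hom_def)
    qed
    ultimately have "digraph_iso (with_proj H1) (with_proj H2 \<restriction> (f ` pverts H1))"
      unfolding digraph_iso_def by metis
    moreover have "induced_subgraph (with_proj H2 \<restriction> (f ` pverts H1)) (with_proj H2)"
      using sub by (intro H2.induced_induce) simp
    ultimately show "H1 \<le>\<^sub>i\<^sub>n\<^sub>d H2" unfolding induced_le_def by blast
  qed
qed

lemma complete_digraph_complete_graph: "complete_digraph n (with_proj (complete_graph n))"
  by (auto simp: complete_digraph_pair_def complete_graph_def)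

lemma pair_graph_complete_graph: "pair_graph (complete_graph n)"
  by (auto simp: pair_graph_iff complete_graph_def sym_def irrefl_def)

lemma pair_graph_edgeless_graph: "pair_graph (edgeless_graph n)"
  by (auto simp: pair_graph_iff edgeless_graph_def sym_def irrefl_def)

lemma pair_graph_path_graph: "pair_graph (path_graph n)"
  by (auto simp: pair_graph_iff path_graph_def sym_def irrefl_def)

lemma pair_graph_join:
  assumes "pair_graph G1" "pair_graph G2"
  shows "pair_graph (join G1 G2)"
proof -
  have "sym (parcs (join G1 G2))"
    using assms unfolding pair_graph_iff join_def sym_def by (auto; blast)
  moreover have "irrefl (parcs (join G1 G2))"
    using assms unfolding pair_graph_iff join_def irrefl_def by (auto simp: sum_encode_eq)
  moreover have "parcs (join G1 G2) \<subseteq> pverts (join G1 G2) \<times> pverts (join G1 G2)"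
    using assms unfolding pair_graph_iff join_def by auto
  ultimately show ?thesis
    using assms unfolding pair_graph_iff by (simp add: join_def)
qed

lemma pair_graph_copies:
  assumes "pair_graph G"
  shows "pair_graph (copies n G)"
proof -
  have "{prod_encode (i, v) | i v. i < n \<and> v \<in> pverts G} = prod_encode ` ({..<n} \<times> pverts G)"
    by auto
  with assms show ?thesis
    unfolding pair_graph_iff copies_def by (auto simp: irrefl_def sym_def prod_encode_eq)
qed

lemma pair_graph_attach_pendants:
  assumes "pair_graph G" "S \<subseteq> pverts G"
  shows "pair_graph (attach_pendants G S)"
proof -
  have "sym (parcs (attach_pendants G S))"
    using assms unfolding pair_graph_iff attach_pendants_def sym_def by (auto; blast)
  moreover have "irrefl (parcs (attach_pendants G S))"
    using assms unfolding pair_graph_iff attach_pendants_def irrefl_def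
    by (auto simp: sum_encode_eq)
  moreover have "parcs (attach_pendants G S)
      \<subseteq> pverts (attach_pendants G S) \<times> pverts (attach_pendants G S)"
    using assms unfolding pair_graph_iff attach_pendants_def by auto
  moreover have "finite S" using assms finite_subset by (auto simp: pair_graph_iff)
  ultimately show ?thesis
    using assms unfolding pair_graph_iff by (simp add: attach_pendants_def)
qed

lemma complete_bipartite_digraph_complete_bipartite_graph:
  "complete_bipartite_digraph s t (with_proj (complete_bipartite_graph s t))"
  unfolding complete_bipartite_digraph_pair_def
proof (intro conjI exI)
  show "card (inl ` {..<s}) = s" "card (inr ` {..<t}) = t"
    by (simp_all add: card_image inj_on_def sum_encode_eq)
qed (auto simp: complete_bipartite_graph_def join_def edgeless_graph_def sum_encode_eq)

lemma pair_graph_complete_bipartite_graph: "pair_graph (complete_bipartite_graph s t)"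
  unfolding complete_bipartite_graph_def by (intro pair_graph_join pair_graph_edgeless_graph)

lemma pair_graph_pendant_complete_graph: "pair_graph (pendant_complete_graph n)"
  unfolding pendant_complete_graph_def
  by (intro pair_graph_attach_pendants pair_graph_complete_graph) simp

lemma pair_graph_pendant_star: "pair_graph (pendant_star n)"
  unfolding pendant_star_def
  by (intro pair_graph_attach_pendants pair_graph_complete_bipartite_graph)
    (auto simp: complete_bipartite_graph_def join_def edgeless_graph_def)

lemma pair_graph_matched_complete_graphs: "pair_graph (matched_complete_graphs n)"
  using pair_graph_copies[OF pair_graph_complete_graph, of 2 n]
  unfolding pair_graph_iff matched_complete_graphs_def
  by (auto simp: irrefl_def sym_def prod_encode_eq copies_def complete_graph_def)

end

theory Submission
  imports Defs "HOL-Library.Ramsey"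
begin

text \<open>
  A vertex has neighbours with independence number at least 2 iff it is the centre of an induced
  path on three vertices; call it non-simplicial. Each of the seven graphs is connected and has at
  least \<open>n - 2\<close> such vertices, which gives one direction.

  Conversely, let \<open>G\<close> be connected without the seven graphs. Geodesics are induced paths, so
  distances from a root are less than \<open>n\<close>. Their inner vertices are non-simplicial, so it suffices
  to bound the number of non-simplicial neighbours \<open>y\<^sub>i\<close> of a single vertex \<open>x\<close>. By Ramsey's theorem
  the \<open>y\<^sub>i\<close> may be taken to form a clique or an independent set, and all adjacencies among the \<open>y\<^sub>i\<close>
  and their witnesses \<open>a\<^sub>i, b\<^sub>i\<close> (non-adjacent neighbours of \<open>y\<^sub>i\<close>) to depend only on the order of the
  indices. If the \<open>y\<^sub>i\<close> form a clique, this yields \<open>E\<^sub>2 + K\<^sub>n\<close>, \<open>K\<^sub>n\<^sup>*\<close> or \<open>CK\<^sub>n\<close>. If they are independent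
  and have neighbours outside the closed neighbourhood of \<open>x\<close>, it yields \<open>K\<^sub>2\<^sub>,\<^sub>n\<close>, \<open>K\<^sub>1\<^sub>,\<^sub>n\<^sup>*\<close> or \<open>K\<^sub>n\<^sup>*\<close>.
  If they are independent and \<open>a\<^sub>i, b\<^sub>i\<close> are neighbours of \<open>x\<close>, it yields \<open>E\<^sub>2 + K\<^sub>n\<close>, \<open>K\<^sub>n\<^sup>*\<close> or
  \<open>K\<^sub>1 + nP\<^sub>3\<close>, or else one of the \<open>a\<^sub>i, b\<^sub>i\<close> can replace \<open>x\<close> as the centre in the previous case.
\<close>

section \<open>Basic facts on graphs\<close>

lemma pair_graph_sym: "pair_graph G \<Longrightarrow> (u, v) \<in> parcs G \<Longrightarrow> (v, u) \<in> parcs G"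
  by (auto simp: pair_graph_iff sym_def)

lemma pair_graph_irrefl: "pair_graph G \<Longrightarrow> (u, u) \<notin> parcs G"
  by (auto simp: pair_graph_iff irrefl_def)

lemma pair_graph_verts:
  "pair_graph G \<Longrightarrow> (u, v) \<in> parcs G \<Longrightarrow> u \<in> pverts G"
  "pair_graph G \<Longrightarrow> (u, v) \<in> parcs G \<Longrightarrow> v \<in> pverts G"
  by (auto simp: pair_graph_iff)

lemma join_simps:
  "pverts (join G1 G2) = inl ` pverts G1 \<union> inr ` pverts G2"
  "(inl a, inl b) \<in> parcs (join G1 G2) \<longleftrightarrow> (a, b) \<in> parcs G1"
  "(inl a, inr c) \<in> parcs (join G1 G2) \<longleftrightarrow> a \<in> pverts G1 \<and> c \<in> pverts G2"
  "(inr c, inl a) \<in> parcs (join G1 G2) \<longleftrightarrow> a \<in> pverts G1 \<and> c \<in> pverts G2"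
  "(inr c, inr d) \<in> parcs (join G1 G2) \<longleftrightarrow> (c, d) \<in> parcs G2"
  by (auto simp: join_def sum_encode_eq)

lemma attach_pendants_simps:
  "pverts (attach_pendants G S) = inl ` pverts G \<union> inr ` S"
  "(inl a, inl b) \<in> parcs (attach_pendants G S) \<longleftrightarrow> (a, b) \<in> parcs G"
  "(inl a, inr s) \<in> parcs (attach_pendants G S) \<longleftrightarrow> a = s \<and> s \<in> S"
  "(inr s, inl a) \<in> parcs (attach_pendants G S) \<longleftrightarrow> a = s \<and> s \<in> S"
  "(inr s, inr t) \<notin> parcs (attach_pendants G S)"
  by (auto simp: attach_pendants_def sum_encode_eq)

lemma copies_simps:
  "pverts (copies n G) = prod_encode ` ({..<n} \<times> pverts G)"
  "(prod_encode (i, u), prod_encode (j, v)) \<in> parcs (copies n G)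
    \<longleftrightarrow> i = j \<and> i < n \<and> (u, v) \<in> parcs G"
  by (auto simp: copies_def prod_encode_eq)

lemma complete_graph_simps:
  "pverts (complete_graph n) = {..<n}"
  "(i, j) \<in> parcs (complete_graph n) \<longleftrightarrow> i < n \<and> j < n \<and> i \<noteq> j"
  by (auto simp: complete_graph_def)

lemma edgeless_graph_simps:
  "pverts (edgeless_graph n) = {..<n}" "parcs (edgeless_graph n) = {}"
  by (auto simp: edgeless_graph_def)

lemma path_graph_simps:
  "pverts (path_graph n) = {..<n}"
  "(i, j) \<in> parcs (path_graph n) \<longleftrightarrow> i < n \<and> j < n \<and> (j = Suc i \<or> i = Suc j)"
  by (auto simp: path_graph_def)

lemma complete_bipartite_graph_simps:
  "pverts (complete_bipartite_graph s t) = inl ` {..<s} \<union> inr ` {..<t}"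
  "(inl a, inl b) \<notin> parcs (complete_bipartite_graph s t)"
  "(inl a, inr c) \<in> parcs (complete_bipartite_graph s t) \<longleftrightarrow> a < s \<and> c < t"
  "(inr c, inl a) \<in> parcs (complete_bipartite_graph s t) \<longleftrightarrow> a < s \<and> c < t"
  "(inr c, inr d) \<notin> parcs (complete_bipartite_graph s t)"
  by (auto simp: complete_bipartite_graph_def join_simps edgeless_graph_simps)

lemma matched_complete_graphs_simps:
  "pverts (matched_complete_graphs n) = prod_encode ` ({..<2} \<times> {..<n})"
  "(prod_encode (i, u), prod_encode (j, v)) \<in> parcs (matched_complete_graphs n)
    \<longleftrightarrow> i < 2 \<and> j < 2 \<and> u < n \<and> v < n \<and> (i = j \<longleftrightarrow> u \<noteq> v)"
  by (auto simp: matched_complete_graphs_def copies_simps complete_graph_simps prod_encode_eq)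

lemmas construction_simps = join_simps attach_pendants_simps copies_simps complete_graph_simps
  edgeless_graph_simps path_graph_simps complete_bipartite_graph_simps
  matched_complete_graphs_simps sum_encode_eq prod_encode_eq

section \<open>Embeddings as induced subgraphs\<close>

lemma induced_leI:
  assumes "pair_graph H1" "pair_graph H2" "inj_on f (pverts H1)"
    and "\<And>u. u \<in> pverts H1 \<Longrightarrow> f u \<in> pverts H2"
    and "\<And>u v. u \<in> pverts H1 \<Longrightarrow> v \<in> pverts H1 \<Longrightarrow> (u, v) \<in> parcs H1 \<longleftrightarrow> (f u, f v) \<in> parcs H2"
  shows "H1 \<le>\<^sub>i\<^sub>n\<^sub>d H2"
  using assms by (auto simp: induced_le_iff)

lemma induced_le_trans:
  assumes "pair_graph H1" "pair_graph H2" "pair_graph H3" "H1 \<le>\<^sub>i\<^sub>n\<^sub>d H2" "H2 \<le>\<^sub>i\<^sub>n\<^sub>d H3"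
  shows "H1 \<le>\<^sub>i\<^sub>n\<^sub>d H3"
proof -
  obtain f where f: "inj_on f (pverts H1)" "f ` pverts H1 \<subseteq> pverts H2"
    "\<forall>u\<in>pverts H1. \<forall>v\<in>pverts H1. (u, v) \<in> parcs H1 \<longleftrightarrow> (f u, f v) \<in> parcs H2"
    using assms by (auto simp: induced_le_iff)
  obtain g where g: "inj_on g (pverts H2)" "g ` pverts H2 \<subseteq> pverts H3"
    "\<forall>u\<in>pverts H2. \<forall>v\<in>pverts H2. (u, v) \<in> parcs H2 \<longleftrightarrow> (g u, g v) \<in> parcs H3"
    using assms by (auto simp: induced_le_iff)
  show ?thesis
  proof (rule induced_leI[where f = "g \<circ> f"])
    show "inj_on (g \<circ> f) (pverts H1)"
      using f(1,2) g(1) by (meson comp_inj_on inj_on_subset)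
  qed (use assms f(2,3) g(2,3) in \<open>auto simp: image_subset_iff\<close>)
qed

section \<open>Recognising the seven graphs\<close>

definition unavoidable :: "nat \<Rightarrow> nat pair_pre_digraph set" where
  "unavoidable n = {pendant_complete_graph n, path_graph n, pendant_star n,
     complete_bipartite_graph 2 n, join (edgeless_graph 2) (complete_graph n),
     join (complete_graph 1) (copies n (path_graph 3)), matched_complete_graphs n}"

definition contains_unavoidable :: "nat \<Rightarrow> 'a pair_pre_digraph \<Rightarrow> bool" where
  "contains_unavoidable n G \<longleftrightarrow> (\<exists>H\<in>unavoidable n. H \<le>\<^sub>i\<^sub>n\<^sub>d G)"

lemmas pair_graph_constructions = pair_graph_pendant_complete_graph pair_graph_path_graph
  pair_graph_pendant_star pair_graph_complete_bipartite_graph pair_graph_join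
  pair_graph_edgeless_graph pair_graph_complete_graph pair_graph_copies
  pair_graph_matched_complete_graphs

lemma pair_graph_unavoidable: "H \<in> unavoidable n \<Longrightarrow> pair_graph H"
  by (auto simp: unavoidable_def intro!: pair_graph_constructions)

text \<open>The prescribed edges and non-edges already force all \<open>y i\<close> and
  \<open>z j\<close> to be distinct. The recognition lemmas below follow the same pattern: vertices
  are separated by their adjacencies, except where an inequality is listed among the
  hypotheses.\<close>

lemma contains_pendant_complete_graph:
  assumes G: "pair_graph G" and yz: "\<forall>i<n. (y i, z i) \<in> parcs G"
    and y: "\<forall>i<n. \<forall>j<n. i \<noteq> j \<longrightarrow> (y i, y j) \<in> parcs G"
    and z: "\<forall>i<n. \<forall>j<n. i \<noteq> j \<longrightarrow> (z i, z j) \<notin> parcs G"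
    and nyz: "\<forall>i<n. \<forall>j<n. i \<noteq> j \<longrightarrow> (y i, z j) \<notin> parcs G"
  shows "contains_unavoidable n G"
proof -
  have inj: "y i \<noteq> y j" "z i \<noteq> z j" if "i < n" "j < n" "i \<noteq> j" for i j
    using that yz y nyz pair_graph_irrefl[OF G] by metis+
  \<comment> \<open>If \<open>y i = z j\<close> for distinct i and j, the edge from
    \<open>y i\<close> to \<open>z i\<close> would join two of the \<open>z\<close>.\<close>
  have neq: "y i \<noteq> z j" if "i < n" "j < n" for i j
    using that y yz nyz z pair_graph_irrefl[OF G] pair_graph_sym[OF G] by metis
  define f where "f = (\<lambda>v. case sum_decode v of Inl i \<Rightarrow> y i | Inr i \<Rightarrow> z i)"
  have verts: "\<forall>i<n. y i \<in> pverts G \<and> z i \<in> pverts G"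
    using yz pair_graph_verts[OF G] by blast
  have yz_iff: "(y i, z j) \<in> parcs G \<longleftrightarrow> i = j" "(z j, y i) \<in> parcs G \<longleftrightarrow> i = j"
    if "i < n" "j < n" for i j
    using that yz nyz pair_graph_sym[OF G] by metis+
  have "pendant_complete_graph n \<le>\<^sub>i\<^sub>n\<^sub>d G"
  proof (rule induced_leI[OF pair_graph_pendant_complete_graph G, where f = f])
    show "inj_on f (pverts (pendant_complete_graph n))"
      using inj neq unfolding f_def
      by (fastforce simp: inj_on_def pendant_complete_graph_def construction_simps)
  next
    fix u v assume "u \<in> pverts (pendant_complete_graph n)" "v \<in> pverts (pendant_complete_graph n)"
    then show "(u, v) \<in> parcs (pendant_complete_graph n) \<longleftrightarrow> (f u, f v) \<in> parcs G"
      using y z pair_graph_irrefl[OF G] unfolding f_def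
      by (auto simp: pendant_complete_graph_def construction_simps yz_iff; metis)
  next
    fix u assume "u \<in> pverts (pendant_complete_graph n)"
    then show "f u \<in> pverts G"
      using verts unfolding f_def by (auto simp: pendant_complete_graph_def construction_simps)
  qed
  then show ?thesis by (auto simp: contains_unavoidable_def unavoidable_def)
qed

text \<open>The only \<open>y\<close> adjacent to \<open>z i\<close> is \<open>y i\<close>, which
  keeps the pairs apart; \<open>x\<close> is adjacent to every \<open>y\<close> and to no
  \<open>z\<close>, which keeps \<open>y\<close> apart from \<open>z\<close>.\<close>

lemma contains_pendant_star:
  assumes G: "pair_graph G" and "n > 0"
    and xy: "\<forall>i<n. (x, y i) \<in> parcs G" and yz: "\<forall>i<n. (y i, z i) \<in> parcs G"
    and xz: "\<forall>i<n. z i \<noteq> x \<and> (x, z i) \<notin> parcs G"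
    and y: "\<forall>i<n. \<forall>j<n. (y i, y j) \<notin> parcs G"
    and z: "\<forall>i<n. \<forall>j<n. (z i, z j) \<notin> parcs G"
    and nyz: "\<forall>i<n. \<forall>j<n. i \<noteq> j \<longrightarrow> (y i, z j) \<notin> parcs G"
  shows "contains_unavoidable n G"
proof -
  have inj: "\<forall>i<n. \<forall>j<n. (y i = y j \<longleftrightarrow> i = j) \<and> (z i = z j \<longleftrightarrow> i = j)"
    using yz y nyz by metis
  have neq: "\<forall>i<n. \<forall>j<n. y i \<noteq> z j \<and> z j \<noteq> y i" "\<forall>i<n. x \<noteq> y i \<and> x \<noteq> z i"
    using xy xz pair_graph_irrefl[OF G] by metis+
  \<comment> \<open>For n = 0 nothing would place \<open>x\<close> in the graph; for n > 0 its edge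
    to \<open>y 0\<close> does.\<close>
  have verts: "x \<in> pverts G" "\<forall>i<n. y i \<in> pverts G" "\<forall>i<n. z i \<in> pverts G"
    using xy yz pair_graph_verts[OF G] \<open>n > 0\<close> by blast+
  have flip: "\<forall>i<n. (y i, x) \<in> parcs G \<and> (z i, y i) \<in> parcs G \<and> (z i, x) \<notin> parcs G"
    using xy yz xz pair_graph_sym[OF G] by metis
  have yz_iff: "(y i, z j) \<in> parcs G \<longleftrightarrow> i = j" "(z j, y i) \<in> parcs G \<longleftrightarrow> i = j"
    if "i < n" "j < n" for i j
    using that yz nyz pair_graph_sym[OF G] by metis+
  \<comment> \<open>Pendants are attached to leaves only, so the value \<open>x\<close> under
    \<open>Inr w\<close> is a default that is never taken on a vertex of the star.\<close>
  define f where "f = (\<lambda>v. case sum_decode v of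
    Inl w \<Rightarrow> (case sum_decode w of Inl _ \<Rightarrow> x | Inr i \<Rightarrow> y i) |
    Inr w \<Rightarrow> (case sum_decode w of Inl _ \<Rightarrow> x | Inr i \<Rightarrow> z i))"
  have "pendant_star n \<le>\<^sub>i\<^sub>n\<^sub>d G"
  proof (rule induced_leI[OF pair_graph_pendant_star G, where f = f])
    show "inj_on f (pverts (pendant_star n))"
      using inj neq unfolding f_def
      by (auto simp: inj_on_def pendant_star_def construction_simps)
  next
    fix u v assume "u \<in> pverts (pendant_star n)" "v \<in> pverts (pendant_star n)"
    then show "(u, v) \<in> parcs (pendant_star n) \<longleftrightarrow> (f u, f v) \<in> parcs G"
      using xy xz y z flip pair_graph_irrefl[OF G] unfolding f_def
      by (auto simp: pendant_star_def construction_simps yz_iff)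
  next
    fix u assume "u \<in> pverts (pendant_star n)"
    then show "f u \<in> pverts G"
      using verts unfolding f_def by (auto simp: pendant_star_def construction_simps)
  qed
  then show ?thesis by (auto simp: contains_unavoidable_def unavoidable_def)
qed

text \<open>The \<open>y i\<close> are independent and may be twins, so adjacency cannot tell them
  apart; hence the explicit injectivity.\<close>

lemma contains_complete_bipartite_graph:
  assumes G: "pair_graph G" and "n > 0" and xz: "x \<noteq> z" "(x, z) \<notin> parcs G"
    and inj: "inj_on y {..<n}"
    and xy: "\<forall>i<n. (x, y i) \<in> parcs G" and zy: "\<forall>i<n. (z, y i) \<in> parcs G"
    and y: "\<forall>i<n. \<forall>j<n. (y i, y j) \<notin> parcs G"
  shows "contains_unavoidable n G"
proof -
  have neq: "\<forall>i<n. x \<noteq> y i \<and> z \<noteq> y i"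
    using xy zy pair_graph_irrefl[OF G] by metis
  have flip: "(z, x) \<notin> parcs G" "\<forall>i<n. (y i, x) \<in> parcs G \<and> (y i, z) \<in> parcs G"
    using xz xy zy pair_graph_sym[OF G] by blast+
  have verts: "x \<in> pverts G" "z \<in> pverts G" "\<forall>i<n. y i \<in> pverts G"
    using xy zy pair_graph_verts[OF G] \<open>n > 0\<close> by blast+
  define f where "f = (\<lambda>v. case sum_decode v of Inl i \<Rightarrow> (if i = 0 then x else z) | Inr i \<Rightarrow> y i)"
  have "complete_bipartite_graph 2 n \<le>\<^sub>i\<^sub>n\<^sub>d G"
  proof (rule induced_leI[OF pair_graph_complete_bipartite_graph G, where f = f])
    show "inj_on f (pverts (complete_bipartite_graph 2 n))"
      using inj neq xz unfolding f_def
      by (auto simp: inj_on_def construction_simps split: if_splits)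
  next
    fix u v assume "u \<in> pverts (complete_bipartite_graph 2 n)" "v \<in> pverts (complete_bipartite_graph 2 n)"
    then show "(u, v) \<in> parcs (complete_bipartite_graph 2 n) \<longleftrightarrow> (f u, f v) \<in> parcs G"
      using xy xz zy y flip pair_graph_irrefl[OF G] unfolding f_def
      by (auto simp: construction_simps split: if_splits)
  next
    fix u assume "u \<in> pverts (complete_bipartite_graph 2 n)"
    then show "f u \<in> pverts G"
      using verts unfolding f_def by (auto simp: construction_simps)
  qed
  then show ?thesis by (auto simp: contains_unavoidable_def unavoidable_def)
qed

lemma contains_join_edgeless_complete:
  assumes G: "pair_graph G" and "n > 0" and xz: "x \<noteq> z" "(x, z) \<notin> parcs G"
    and xy: "\<forall>i<n. (x, y i) \<in> parcs G" and zy: "\<forall>i<n. (z, y i) \<in> parcs G"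
    and y: "\<forall>i<n. \<forall>j<n. i \<noteq> j \<longrightarrow> (y i, y j) \<in> parcs G"
  shows "contains_unavoidable n G"
proof -
  have neq: "\<forall>i<n. x \<noteq> y i \<and> z \<noteq> y i"
    using xy zy pair_graph_irrefl[OF G] by metis
  have flip: "(z, x) \<notin> parcs G" "\<forall>i<n. (y i, x) \<in> parcs G \<and> (y i, z) \<in> parcs G"
    using xz xy zy pair_graph_sym[OF G] by blast+
  have verts: "x \<in> pverts G" "z \<in> pverts G" "\<forall>i<n. y i \<in> pverts G"
    using xy zy pair_graph_verts[OF G] \<open>n > 0\<close> by blast+
  have inj: "inj_on y {..<n}"
    using y pair_graph_irrefl[OF G] by (metis inj_onI lessThan_iff)
  define f where "f = (\<lambda>v. case sum_decode v of Inl i \<Rightarrow> (if i = 0 then x else z) | Inr i \<Rightarrow> y i)"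
  let ?H = "join (edgeless_graph 2) (complete_graph n)"
  have "?H \<le>\<^sub>i\<^sub>n\<^sub>d G"
  proof (rule induced_leI[OF _ G, where f = f])
    show "inj_on f (pverts ?H)"
      using inj neq xz unfolding f_def
      by (auto simp: inj_on_def construction_simps split: if_splits)
  next
    fix u v assume "u \<in> pverts ?H" "v \<in> pverts ?H"
    then show "(u, v) \<in> parcs ?H \<longleftrightarrow> (f u, f v) \<in> parcs G"
      using xy xz zy y flip pair_graph_irrefl[OF G] unfolding f_def
      by (auto simp: construction_simps split: if_splits)
  next
    fix u assume "u \<in> pverts ?H"
    then show "f u \<in> pverts G"
      using verts unfolding f_def by (auto simp: construction_simps)
  qed (intro pair_graph_constructions)
  then show ?thesis by (auto simp: contains_unavoidable_def unavoidable_def)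
qed

text \<open>The inequality between \<open>y i\<close> and \<open>z j\<close> is explicit because for
  n = 2 the adjacencies also hold in a path on three vertices, with \<open>y 0 = z 1\<close> as its
  middle.\<close>

lemma contains_matched_complete_graphs:
  assumes G: "pair_graph G" and yz: "\<forall>i<n. (y i, z i) \<in> parcs G"
    and y: "\<forall>i<n. \<forall>j<n. i \<noteq> j \<longrightarrow> (y i, y j) \<in> parcs G"
    and z: "\<forall>i<n. \<forall>j<n. i \<noteq> j \<longrightarrow> (z i, z j) \<in> parcs G"
    and nyz: "\<forall>i<n. \<forall>j<n. i \<noteq> j \<longrightarrow> y i \<noteq> z j \<and> (y i, z j) \<notin> parcs G"
  shows "contains_unavoidable n G"
proof -
  have inj: "\<forall>i<n. \<forall>j<n. (y i = y j \<longleftrightarrow> i = j) \<and> (z i = z j \<longleftrightarrow> i = j)"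
    using y z pair_graph_irrefl[OF G] by metis
  have neq: "\<forall>i<n. \<forall>j<n. y i \<noteq> z j \<and> z j \<noteq> y i"
    using yz nyz pair_graph_irrefl[OF G] by metis
  have verts: "\<forall>i<n. y i \<in> pverts G \<and> z i \<in> pverts G"
    using yz pair_graph_verts[OF G] by blast
  have yz_iff: "(y i, z j) \<in> parcs G \<longleftrightarrow> i = j" "(z j, y i) \<in> parcs G \<longleftrightarrow> i = j"
    if "i < n" "j < n" for i j
    using that yz nyz pair_graph_sym[OF G] by metis+
  define f where "f = (\<lambda>v. case prod_decode v of (k, i) \<Rightarrow> if k = 0 then y i else z i)"
  let ?H = "matched_complete_graphs n"
  have two: "k = 0 \<or> k = 1" if "k < 2" for k :: nat using that by auto
  have "?H \<le>\<^sub>i\<^sub>n\<^sub>d G"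
  proof (rule induced_leI[OF pair_graph_matched_complete_graphs G, where f = f])
    show "inj_on f (pverts ?H)"
      using inj neq unfolding f_def
      by (auto simp: inj_on_def construction_simps split: if_splits dest!: two)
  next
    fix u v assume "u \<in> pverts ?H" "v \<in> pverts ?H"
    then obtain k i l j where "u = prod_encode (k, i)" "v = prod_encode (l, j)"
      "k < 2" "l < 2" "i < n" "j < n" by (auto simp: construction_simps)
    then show "(u, v) \<in> parcs ?H \<longleftrightarrow> (f u, f v) \<in> parcs G"
      using y z yz_iff pair_graph_irrefl[OF G] two[of k] two[of l] unfolding f_def
      by (auto simp: construction_simps split: if_splits)
  next
    fix u assume "u \<in> pverts ?H"
    then show "f u \<in> pverts G"
      using verts unfolding f_def by (auto simp: construction_simps)
  qed
  then show ?thesis by (auto simp: contains_unavoidable_def unavoidable_def)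
qed

lemma contains_join_copies_path:
  assumes G: "pair_graph G" and "n > 0"
    and x: "\<forall>i<n. (x, a i) \<in> parcs G \<and> (x, y i) \<in> parcs G \<and> (x, b i) \<in> parcs G"
    and ayb: "\<forall>i<n. (y i, a i) \<in> parcs G \<and> (y i, b i) \<in> parcs G \<and> a i \<noteq> b i \<and> (a i, b i) \<notin> parcs G"
    and non: "\<forall>i<n. \<forall>j<n. i \<noteq> j \<longrightarrow> (a i, a j) \<notin> parcs G \<and> (b i, b j) \<notin> parcs G \<and>
      (y i, y j) \<notin> parcs G \<and> (a i, b j) \<notin> parcs G \<and> (y i, a j) \<notin> parcs G \<and> (y i, b j) \<notin> parcs G"
  shows "contains_unavoidable n G"
proof -
  \<comment> \<open>\<open>q i\<close> runs along the i-th path in the order of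
    \<open>path_graph 3\<close>, so that adjacency within a path becomes the successor relation on
    the positions.\<close>
  define q where "q = (\<lambda>i (k::nat). if k = 0 then a i else if k = 1 then y i else b i :: 'a)"
  define f where "f = (\<lambda>v. case sum_decode v of Inl _ \<Rightarrow> x |
    Inr w \<Rightarrow> (case prod_decode w of (i, k) \<Rightarrow> q i k))"
  have three: "k = 0 \<or> k = 1 \<or> k = 2" if "k < 3" for k :: nat using that by auto
  have verts: "x \<in> pverts G" "\<forall>i<n. \<forall>k. q i k \<in> pverts G"
    using x pair_graph_verts[OF G] \<open>n > 0\<close> by (auto simp: q_def)
  have xq: "(x, q i k) \<in> parcs G" if "i < n" for i k
    using x that by (auto simp: q_def)
  have q1: "(q i k, q i l) \<in> parcs G \<longleftrightarrow> (l = Suc k \<or> k = Suc l)" if "i < n" "k < 3" "l < 3" for i k l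
  proof -
    have "(a i, y i) \<in> parcs G" "(b i, y i) \<in> parcs G" "(b i, a i) \<notin> parcs G"
      using ayb that(1) pair_graph_sym[OF G] by blast+
    then show ?thesis
      using ayb that three[of k] three[of l] pair_graph_irrefl[OF G] by (auto simp: q_def)
  qed
  have q2: "(q i k, q j l) \<notin> parcs G" if "i < n" "j < n" "i \<noteq> j" for i j k l
  proof -
    have "(b i, a j) \<notin> parcs G" "(a i, y j) \<notin> parcs G" "(b i, y j) \<notin> parcs G"
      using non that pair_graph_sym[OF G] by blast+
    then show ?thesis using non that by (simp add: q_def)
  qed
  have qinj: "i = j \<and> k = l" if "q i k = q j l" "i < n" "j < n" "k < 3" "l < 3" for i j k l
  proof -
    have "i = j"
    proof (rule ccontr)
      assume "i \<noteq> j"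
      \<comment> \<open>Each position has a neighbouring position on its own path. If
        \<open>q i k = q j l\<close> with distinct i and j, the edge to that neighbour would run
        between two different paths.\<close>
      obtain m where "m < 3" "m = Suc k \<or> k = Suc m"
        using \<open>k < 3\<close> by (cases "k = 0") (use that[of 1] that[of "k - 1"] in auto)
      then have "(q i k, q i m) \<in> parcs G" using q1[OF that(2,4) \<open>m < 3\<close>] by blast
      then show False using that q2[of j i] \<open>i \<noteq> j\<close> by simp
    qed
    moreover have "a j \<noteq> b j" "a j \<noteq> y j" "b j \<noteq> y j"
      using ayb \<open>j < n\<close> pair_graph_irrefl[OF G] by metis+
    then have "k = l" using that(1) \<open>i = j\<close> three[OF \<open>k < 3\<close>] three[OF \<open>l < 3\<close>]
      unfolding q_def by (auto split: if_splits)
    ultimately show ?thesis by simp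
  qed
  let ?H = "join (complete_graph 1) (copies n (path_graph 3))"
  have "?H \<le>\<^sub>i\<^sub>n\<^sub>d G"
  proof (rule induced_leI[OF _ G, where f = f])
    show "inj_on f (pverts ?H)"
    proof -
      have "x \<noteq> q i k" "q i k \<noteq> x" if "i < n" for i k
        using xq[OF that] pair_graph_irrefl[OF G] by metis+
      then show ?thesis
        unfolding f_def by (auto simp: inj_on_def construction_simps dest: qinj)
    qed
  next
    have qx: "(q i k, x) \<in> parcs G" if "i < n" for i k
      using xq[OF that] pair_graph_sym[OF G] by blast
    have qq: "(q i k, q j l) \<in> parcs G \<longleftrightarrow> i = j \<and> (l = Suc k \<or> k = Suc l)"
      if "i < n" "j < n" "k < 3" "l < 3" for i j k l
      using q1 q2 that by (cases "i = j") simp_all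
    fix u v assume "u \<in> pverts ?H" "v \<in> pverts ?H"
    then show "(u, v) \<in> parcs ?H \<longleftrightarrow> (f u, f v) \<in> parcs G"
      using pair_graph_irrefl[OF G] unfolding f_def
      by (auto simp: construction_simps xq qx qq)
  next
    fix u assume "u \<in> pverts ?H"
    then show "f u \<in> pverts G"
      using verts unfolding f_def by (auto simp: construction_simps)
  qed (intro pair_graph_constructions)
  then show ?thesis by (auto simp: contains_unavoidable_def unavoidable_def)
qed

section \<open>A Ramsey theorem for several relations\<close>

text \<open>Only pairs i < j are constrained. For a relation between two different sequences the
  other order enters as a second relation with swapped arguments; for adjacency within one sequence,
  which is symmetric, one order suffices.\<close>

definition homogeneous :: "nat \<Rightarrow> (nat \<Rightarrow> nat \<Rightarrow> bool) \<Rightarrow> bool" where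
  "homogeneous m R \<longleftrightarrow> (\<forall>j<m. \<forall>i<j. R i j) \<or> (\<forall>j<m. \<forall>i<j. \<not> R i j)"

text \<open>Colour the pair of i < j by the truth value of \<open>R i j\<close> and apply Ramsey's
  theorem for two colours. Listing the resulting set increasingly preserves the order on which the
  colouring depends.\<close>

lemma ramsey_rel:
  fixes m :: nat
  shows "\<exists>N. \<forall>R::nat \<Rightarrow> nat \<Rightarrow> bool. \<exists>e. strict_mono_on {..<m} e \<and> e ` {..<m} \<subseteq> {..<N} \<and>
    homogeneous m (\<lambda>i j. R (e i) (e j))"
proof -
  obtain r where r: "\<forall>(V::nat set) E. finite V \<and> card V \<ge> r \<longrightarrow>
    (\<exists>S \<subseteq> V. card S = m \<and> clique S E \<or> card S = m \<and> indep S E)"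
    using ramsey2[of m m] by blast
  show ?thesis
  proof (intro exI[of _ r] allI)
    fix R :: "nat \<Rightarrow> nat \<Rightarrow> bool"
    let ?E = "{{i, j} | i j. i < j \<and> R i j}"
    have edge: "{i, j} \<in> ?E \<longleftrightarrow> R i j" if "i < j" for i j
      using that by (auto simp: doubleton_eq_iff)
    obtain S where S: "S \<subseteq> {..<r}" "card S = m" "clique S ?E \<or> indep S ?E"
      using r[rule_format, of "{..<r}" ?E] by auto
    have "finite S" using S(1) finite_subset by blast
    then obtain e where e: "strict_mono_on {..<m} e" "\<forall>i<m. e i \<in> S"
      using finite_enumerate[of S] S(2) by auto
    then have elt: "e i < e j" if "i < j" "j < m" for i j
      using that by (auto simp: strict_mono_on_def)
    have "homogeneous m (\<lambda>i j. R (e i) (e j))"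
      using S(3)
    proof
      assume "clique S ?E"
      then have "\<forall>j<m. \<forall>i<j. R (e i) (e j)"
        using e(2) edge[OF elt] elt unfolding clique_def
        by (metis (no_types, lifting) less_irrefl less_trans)
      then show ?thesis by (simp add: homogeneous_def)
    next
      assume "indep S ?E"
      then have "\<forall>j<m. \<forall>i<j. \<not> R (e i) (e j)"
        using e(2) edge[OF elt] elt unfolding indep_def
        by (metis (no_types, lifting) less_irrefl less_trans)
      then show ?thesis by (simp add: homogeneous_def)
    qed
    moreover have "e ` {..<m} \<subseteq> {..<r}" using e(2) S(1) by auto
    ultimately show "\<exists>e. strict_mono_on {..<m} e \<and> e ` {..<m} \<subseteq> {..<r} \<and>
        homogeneous m (\<lambda>i j. R (e i) (e j))"
      using e(1) by blast
  qed
qed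

text \<open>The relations are treated one after another: homogeneity is inherited by increasing
  subsequences. The tail of the list is made homogeneous on \<open>M\<close> indices, where
  \<open>M\<close> is large enough to treat the head afterwards.\<close>

lemma ramsey_rels:
  fixes m :: nat
  shows "\<exists>N. \<forall>Rs::(nat \<Rightarrow> nat \<Rightarrow> bool) list. length Rs = k \<longrightarrow>
    (\<exists>e. strict_mono_on {..<m} e \<and> e ` {..<m} \<subseteq> {..<N} \<and>
      (\<forall>R\<in>set Rs. homogeneous m (\<lambda>i j. R (e i) (e j))))"
proof (induction k arbitrary: m)
  case 0
  show ?case by (intro exI[of _ m] allI impI exI[of _ id]) (auto simp: strict_mono_on_def)
next
  case (Suc k)
  obtain M where M: "\<And>R::nat \<Rightarrow> nat \<Rightarrow> bool. \<exists>e. strict_mono_on {..<m} e \<and> e ` {..<m} \<subseteq> {..<M} \<and>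
    homogeneous m (\<lambda>i j. R (e i) (e j))"
    using ramsey_rel by blast
  obtain N where N: "\<And>Rs::(nat \<Rightarrow> nat \<Rightarrow> bool) list. length Rs = k \<Longrightarrow>
    \<exists>e. strict_mono_on {..<M} e \<and> e ` {..<M} \<subseteq> {..<N} \<and>
      (\<forall>R\<in>set Rs. homogeneous M (\<lambda>i j. R (e i) (e j)))"
    using Suc.IH[of M] by blast
  show ?case
  proof (intro exI[of _ N] allI impI)
    fix Rs :: "(nat \<Rightarrow> nat \<Rightarrow> bool) list" assume "length Rs = Suc k"
    then obtain Q Qs where Rs: "Rs = Q # Qs" "length Qs = k" by (auto simp: length_Suc_conv)
    obtain e where e: "strict_mono_on {..<M} e" "e ` {..<M} \<subseteq> {..<N}"
      "\<forall>R\<in>set Qs. homogeneous M (\<lambda>i j. R (e i) (e j))"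
      using N[OF Rs(2)] by blast
    obtain d where d: "strict_mono_on {..<m} d" "d ` {..<m} \<subseteq> {..<M}"
      "homogeneous m (\<lambda>i j. Q (e (d i)) (e (d j)))"
      using M[of "\<lambda>i j. Q (e i) (e j)"] by blast
    have dM: "d j < M" if "j < m" for j using d(2) that by auto
    have dlt: "d i < d j" if "i < j" "j < m" for i j
      using d(1) that by (auto simp: strict_mono_on_def)
    have "strict_mono_on {..<m} (e \<circ> d)"
      using e(1) dM dlt by (auto simp: strict_mono_on_def)
    moreover have "(e \<circ> d) ` {..<m} \<subseteq> {..<N}"
      using e(2) dM by auto
    moreover have "homogeneous m (\<lambda>i j. R ((e \<circ> d) i) ((e \<circ> d) j))" if "R \<in> set Rs" for R
    proof (cases "R = Q")
      case True
      then show ?thesis using d(3) by simp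
    next
      case False
      then have "R \<in> set Qs" using that Rs(1) by simp
      then have "homogeneous M (\<lambda>i j. R (e i) (e j))" using e(3) by blast
      then show ?thesis using dM dlt by (auto simp: homogeneous_def)
    qed
    ultimately show "\<exists>e. strict_mono_on {..<m} e \<and> e ` {..<m} \<subseteq> {..<N} \<and>
      (\<forall>R\<in>set Rs. homogeneous m (\<lambda>i j. R (e i) (e j)))"
      by (intro exI[of _ "e \<circ> d"] conjI ballI)
  qed
qed

text \<open>\<open>N\<close> is fixed before the relations, hence before the graph whose adjacencies
  they express; this makes all later bounds uniform in the graph.\<close>

lemma homogeneous_subsequence:
  obtains N where "\<And>Rs::(nat \<Rightarrow> nat \<Rightarrow> bool) list. length Rs = k \<Longrightarrow>
    \<exists>e. strict_mono_on {..<m} e \<and> inj_on e {..<m} \<and> (\<forall>i<m. e i < N) \<and> (\<forall>R\<in>set Rs. homogeneous m (\<lambda>i j. R (e i) (e j)))"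
  using ramsey_rels[of k m] strict_mono_on_imp_inj_on by (metis image_subset_iff lessThan_iff)

section \<open>Many neighbours that are centres of induced paths\<close>

lemma all_distinct_pairsI:
  fixes m :: nat
  assumes "\<forall>j<m. \<forall>i<j. P i j" "\<forall>j<m. \<forall>i<j. P j i"
  shows "\<forall>i<m. \<forall>j<m. i \<noteq> j \<longrightarrow> P i j"
  using assms by (metis linorder_neqE_nat)

text \<open>If the edges between \<open>z i\<close> and \<open>y j\<close> are all present for one
  order of the indices, a single extreme \<open>z\<close> together with \<open>x\<close> is complete
  to n of the \<open>y\<close>, which is \<open>K_{2,n}\<close>. Otherwise each \<open>z i\<close>
  is attached to \<open>y i\<close> alone; a clique of the \<open>z\<close> then gives
  \<open>K_n^*\<close>, and an independent set of them gives \<open>K_{1,n}^*\<close> with centre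
  \<open>x\<close>.\<close>

lemma star_with_outer_neighbours:
  assumes "n > 0"
  shows "\<exists>N::nat. \<forall>(G :: 'a pair_pre_digraph) x y z. pair_graph G \<longrightarrow> inj_on y {..<N} \<longrightarrow>
    (\<forall>i<N. (x, y i) \<in> parcs G) \<longrightarrow> (\<forall>i<N. \<forall>j<N. (y i, y j) \<notin> parcs G) \<longrightarrow>
    (\<forall>i<N. (y i, z i) \<in> parcs G \<and> z i \<noteq> x \<and> (x, z i) \<notin> parcs G) \<longrightarrow>
    contains_unavoidable n G"
proof -
  \<comment> \<open>One index more than n: it supplies the second centre \<open>Z 0\<close> or
    \<open>Z n\<close>, and the remaining n supply the leaves.\<close>
  obtain N where N: "\<And>Rs::(nat \<Rightarrow> nat \<Rightarrow> bool) list. length Rs = 3 \<Longrightarrow>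
    \<exists>e. strict_mono_on {..<Suc n} e \<and> inj_on e {..<Suc n} \<and> (\<forall>i<Suc n. e i < N) \<and>
      (\<forall>R\<in>set Rs. homogeneous (Suc n) (\<lambda>i j. R (e i) (e j)))"
    using homogeneous_subsequence[of 3 "Suc n"] by blast
  show ?thesis
  proof (intro exI[of _ N] allI impI)
    fix G :: "'a pair_pre_digraph" and x y z
    assume G: "pair_graph G" and inj: "inj_on y {..<N}" and xy: "\<forall>i<N. (x, y i) \<in> parcs G"
      and yy: "\<forall>i<N. \<forall>j<N. (y i, y j) \<notin> parcs G"
      and z: "\<forall>i<N. (y i, z i) \<in> parcs G \<and> z i \<noteq> x \<and> (x, z i) \<notin> parcs G"
    let ?E = "\<lambda>u v. (u, v) \<in> parcs G"
    obtain e where e: "inj_on e {..<Suc n}" "\<forall>i<Suc n. e i < N"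
      and hom: "homogeneous (Suc n) (\<lambda>i j. ?E (z (e i)) (y (e j)))"
        "homogeneous (Suc n) (\<lambda>i j. ?E (z (e j)) (y (e i)))"
        "homogeneous (Suc n) (\<lambda>i j. ?E (z (e i)) (z (e j)))"
      using N[of "[\<lambda>i j. ?E (z i) (y j), \<lambda>i j. ?E (z j) (y i), \<lambda>i j. ?E (z i) (z j)]"] by auto
    define Y Z where YZ_def: "Y = y \<circ> e" "Z = z \<circ> e"
    have Y: "inj_on Y {..<Suc n}"
      unfolding YZ_def using e inj by (intro comp_inj_on) (auto intro: inj_on_subset)
    have xY: "\<forall>i<Suc n. ?E x (Y i)" and YY: "\<forall>i<Suc n. \<forall>j<Suc n. \<not> ?E (Y i) (Y j)"
      and Z: "\<forall>i<Suc n. ?E (Y i) (Z i) \<and> Z i \<noteq> x \<and> \<not> ?E x (Z i)"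
      using xy yy z e(2) by (auto simp: YZ_def)
    consider (up) "\<forall>j<Suc n. \<forall>i<j. ?E (Z i) (Y j)" | (down) "\<forall>j<Suc n. \<forall>i<j. ?E (Z j) (Y i)"
      | (none) "\<forall>j<Suc n. \<forall>i<j. \<not> ?E (Z i) (Y j)" "\<forall>j<Suc n. \<forall>i<j. \<not> ?E (Z j) (Y i)"
      using hom(1,2) unfolding homogeneous_def YZ_def by fastforce
    then show "contains_unavoidable n G"
    proof cases
      case up
      show ?thesis
      proof (rule contains_complete_bipartite_graph[OF G \<open>n > 0\<close>, of x "Z 0" "\<lambda>i. Y (Suc i)"])
        show "inj_on (\<lambda>i. Y (Suc i)) {..<n}"
          using Y by (auto simp: inj_on_def)
      qed (use up xY YY Z in auto)
    next
      case down
      show ?thesis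
      proof (rule contains_complete_bipartite_graph[OF G \<open>n > 0\<close>, of x "Z n" Y])
        show "inj_on Y {..<n}"
          using Y by (rule inj_on_subset) auto
      qed (use down xY YY Z in auto)
    next
      case none
      have ZY: "\<forall>i<Suc n. \<forall>j<Suc n. i \<noteq> j \<longrightarrow> \<not> ?E (Z i) (Y j)"
        using all_distinct_pairsI[of "Suc n" "\<lambda>i j. \<not> ?E (Z i) (Y j)"] none by blast
      then have YZ: "\<forall>i<Suc n. \<forall>j<Suc n. i \<noteq> j \<longrightarrow> \<not> ?E (Y i) (Z j)"
        using pair_graph_sym[OF G] by metis
      from hom(3) consider (clique) "\<forall>j<Suc n. \<forall>i<j. ?E (Z i) (Z j)"
        | (indep) "\<forall>j<Suc n. \<forall>i<j. \<not> ?E (Z i) (Z j)"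
        unfolding homogeneous_def YZ_def by fastforce
      then show ?thesis
      proof cases
        case clique
        then have ZZ: "\<forall>i<Suc n. \<forall>j<Suc n. i \<noteq> j \<longrightarrow> ?E (Z i) (Z j)"
          using all_distinct_pairsI[of "Suc n" "\<lambda>i j. ?E (Z i) (Z j)"] pair_graph_sym[OF G] by blast
        \<comment> \<open>The roles are exchanged here: the outer vertices \<open>Z\<close> form the
          clique and the \<open>Y\<close> are their pendants.\<close>
        show ?thesis
          by (rule contains_pendant_complete_graph[OF G, of n Z Y])
            (use Z ZZ YY ZY pair_graph_sym[OF G] in \<open>simp_all\<close>)
      next
        case indep
        then have "\<forall>i<Suc n. \<forall>j<Suc n. i \<noteq> j \<longrightarrow> \<not> ?E (Z i) (Z j)"
          using all_distinct_pairsI[of "Suc n" "\<lambda>i j. \<not> ?E (Z i) (Z j)"] pair_graph_sym[OF G] by blast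
        then have ZZ: "\<forall>i<Suc n. \<forall>j<Suc n. \<not> ?E (Z i) (Z j)"
          using pair_graph_irrefl[OF G] by metis
        show ?thesis
          by (rule contains_pendant_star[OF G \<open>n > 0\<close>, of x Y Z]) (use xY Z YY ZZ YZ in auto)
      qed
    qed
  qed
qed

text \<open>The sequence \<open>a\<close> may be taken constant, a clique, or independent with
  distinct members. A constant \<open>a\<close> is the centre of a star with outer neighbours
  \<open>b i\<close>. A clique has n members that are all adjacent to two later \<open>y\<close>,
  which is \<open>E_2 + K_n\<close>. In the independent case \<open>a 0\<close> is the centre of a
  star in which the later \<open>a i\<close> are the outer neighbours.\<close>

lemma independent_with_nested_neighbours:
  assumes "n > 0"
  shows "\<exists>N::nat. \<forall>(G :: 'a pair_pre_digraph) y a b. pair_graph G \<longrightarrow> inj_on y {..<N} \<longrightarrow>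
    (\<forall>i<N. \<forall>j<N. (y i, y j) \<notin> parcs G) \<longrightarrow>
    (\<forall>j<N. \<forall>i\<le>j. (a i, y j) \<in> parcs G) \<longrightarrow>
    (\<forall>i<N. (y i, b i) \<in> parcs G \<and> a i \<noteq> b i \<and> (a i, b i) \<notin> parcs G) \<longrightarrow>
    contains_unavoidable n G"
proof -
  obtain M :: nat where M: "\<forall>(G :: 'a pair_pre_digraph) x y z. pair_graph G \<longrightarrow> inj_on y {..<M} \<longrightarrow>
    (\<forall>i<M. (x, y i) \<in> parcs G) \<longrightarrow> (\<forall>i<M. \<forall>j<M. (y i, y j) \<notin> parcs G) \<longrightarrow>
    (\<forall>i<M. (y i, z i) \<in> parcs G \<and> z i \<noteq> x \<and> (x, z i) \<notin> parcs G) \<longrightarrow>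
    contains_unavoidable n G"
    using star_with_outer_neighbours[OF assms] ..
  \<comment> \<open>\<open>Suc M\<close> indices for a star whose centre uses index 0;
    \<open>n + 2\<close> for a clique of n vertices and two later vertices of
    \<open>Y\<close>.\<close>
  define m where "m = Suc M + (n + 2)"
  obtain N where N: "\<And>Rs::(nat \<Rightarrow> nat \<Rightarrow> bool) list. length Rs = 2 \<Longrightarrow>
    \<exists>e. strict_mono_on {..<m} e \<and> inj_on e {..<m} \<and> (\<forall>i<m. e i < N) \<and>
      (\<forall>R\<in>set Rs. homogeneous m (\<lambda>i j. R (e i) (e j)))"
    using homogeneous_subsequence[of 2 m] by blast
  show ?thesis
  proof (intro exI[of _ N] allI impI)
    fix G :: "'a pair_pre_digraph" and y a b
    let ?E = "\<lambda>u v. (u, v) \<in> parcs G"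
    assume G: "pair_graph G" and inj: "inj_on y {..<N}"
      and yy: "\<forall>i<N. \<forall>j<N. (y i, y j) \<notin> parcs G"
      and ay: "\<forall>j<N. \<forall>i\<le>j. (a i, y j) \<in> parcs G"
      and b: "\<forall>i<N. (y i, b i) \<in> parcs G \<and> a i \<noteq> b i \<and> (a i, b i) \<notin> parcs G"
    obtain e where e: "strict_mono_on {..<m} e" "inj_on e {..<m}" "\<forall>i<m. e i < N"
      and hom: "homogeneous m (\<lambda>i j. a (e i) = a (e j))"
        "homogeneous m (\<lambda>i j. ?E (a (e i)) (a (e j)))"
      using N[of "[\<lambda>i j. a i = a j, \<lambda>i j. ?E (a i) (a j)]"] by auto
    \<comment> \<open>The nested condition compares i with j, so the subsequence has to be
      increasing and not merely injective.\<close>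
    have emono: "e i \<le> e j" if "i \<le> j" "j < m" for i j
      using e(1) that by (cases "i = j") (auto simp: strict_mono_on_def less_imp_le)
    define Y A B where YAB_def: "Y = y \<circ> e" "A = a \<circ> e" "B = b \<circ> e"
    have Y: "inj_on Y {..<m}"
      unfolding YAB_def using e(2,3) inj
      by (intro comp_inj_on) (auto intro: inj_on_subset)
    have YY: "\<forall>i<m. \<forall>j<m. \<not> ?E (Y i) (Y j)" and AY: "\<forall>j<m. \<forall>i\<le>j. ?E (A i) (Y j)"
      and B: "\<forall>i<m. ?E (Y i) (B i) \<and> A i \<noteq> B i \<and> \<not> ?E (A i) (B i)"
      using yy ay b e(3) emono by (auto simp: YAB_def)
    have Y': "inj_on (\<lambda>i. Y (Suc i)) {..<M}"
    proof (rule inj_onI)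
      fix i j assume "i \<in> {..<M}" "j \<in> {..<M}" "Y (Suc i) = Y (Suc j)"
      then show "i = j" using inj_onD[OF Y, of "Suc i" "Suc j"] by (simp add: m_def)
    qed
    consider (eq) "\<forall>j<m. \<forall>i<j. A i = A j" | (clique) "\<forall>j<m. \<forall>i<j. ?E (A i) (A j)"
      | (indep) "\<forall>j<m. \<forall>i<j. A i \<noteq> A j" "\<forall>j<m. \<forall>i<j. \<not> ?E (A i) (A j)"
      using hom unfolding homogeneous_def YAB_def comp_def by argo
    then show "contains_unavoidable n G"
    proof cases
      case eq
      have A0: "A (Suc i) = A 0" if "i < M" for i
        by (rule eq[rule_format, symmetric]; use that in \<open>simp add: m_def\<close>)
      show ?thesis
      proof (rule M[rule_format, OF G Y', where x = "A 0" and z = "\<lambda>i. B (Suc i)"])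
        fix i assume "i < M"
        then have "Suc i < m" by (simp add: m_def)
        then show "?E (Y (Suc i)) (B (Suc i)) \<and> B (Suc i) \<noteq> A 0 \<and> \<not> ?E (A 0) (B (Suc i))"
          using B A0[OF \<open>i < M\<close>] by metis
      qed (use AY YY in \<open>simp_all add: m_def\<close>)
    next
      case clique
      have nm: "n < m" "Suc n < m" by (auto simp: m_def)
      have "\<forall>i<m. \<forall>j<m. i \<noteq> j \<longrightarrow> ?E (A i) (A j)"
        using all_distinct_pairsI[of m "\<lambda>i j. ?E (A i) (A j)"] clique pair_graph_sym[OF G] by blast
      then have AA: "\<forall>i<n. \<forall>j<n. i \<noteq> j \<longrightarrow> ?E (A i) (A j)" by (simp add: m_def)
      have "Y n \<noteq> Y (Suc n)" using inj_onD[OF Y, of n "Suc n"] nm by auto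
      moreover have "\<forall>i<n. ?E (Y n) (A i)" "\<forall>i<n. ?E (Y (Suc n)) (A i)"
        using AY nm pair_graph_sym[OF G] by (simp_all add: less_imp_le)
      ultimately show ?thesis
        using AA YY nm by (intro contains_join_edgeless_complete[OF G \<open>n > 0\<close>, of "Y n" "Y (Suc n)" A]) auto
    next
      case indep
      show ?thesis
      proof (rule M[rule_format, OF G Y', where x = "A 0" and z = "\<lambda>i. A (Suc i)"])
          fix i assume "i < M"
          then have "Suc i < m" by (simp add: m_def)
          then show "?E (Y (Suc i)) (A (Suc i)) \<and> A (Suc i) \<noteq> A 0 \<and> \<not> ?E (A 0) (A (Suc i))"
            using AY indep pair_graph_sym[OF G] by (metis order_refl zero_less_Suc)
      qed (use AY YY in \<open>simp_all add: m_def\<close>)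
    qed
  qed
qed

text \<open>By homogeneity the edges between \<open>a i\<close> and \<open>y j\<close> for distinct
  indices follow one of four patterns. If exactly one order carries edges, some \<open>a\<close> and
  some \<open>y\<close> are non-adjacent with n common neighbours in the clique, which is
  \<open>E_2 + K_n\<close>. If there are none, the \<open>a i\<close> yield \<open>CK_n\<close> or
  \<open>K_n^*\<close>. If all are present, the second alternative hands this pattern on, with a
  length \<open>l\<close> chosen by the caller.\<close>

lemma clique_with_private_neighbours:
  fixes l :: nat
  assumes "n > 0"
  shows "\<exists>N::nat. \<forall>(G :: 'a pair_pre_digraph) y a. pair_graph G \<longrightarrow>
    (\<forall>i<N. \<forall>j<N. i \<noteq> j \<longrightarrow> (y i, y j) \<in> parcs G) \<longrightarrow> (\<forall>i<N. (y i, a i) \<in> parcs G) \<longrightarrow>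
    contains_unavoidable n G \<or>
    (\<exists>e. inj_on e {..<l} \<and> (\<forall>i<l. e i < N) \<and> (\<forall>i<l. \<forall>j<l. (a (e i), y (e j)) \<in> parcs G))"
proof -
  define m where "m = l + (n + 3)"
  obtain N where N: "\<And>Rs::(nat \<Rightarrow> nat \<Rightarrow> bool) list. length Rs = 5 \<Longrightarrow>
    \<exists>e. strict_mono_on {..<m} e \<and> inj_on e {..<m} \<and> (\<forall>i<m. e i < N) \<and>
      (\<forall>R\<in>set Rs. homogeneous m (\<lambda>i j. R (e i) (e j)))"
    using homogeneous_subsequence[of 5 m] by blast
  show ?thesis
  proof (intro exI[of _ N] allI impI)
    fix G :: "'a pair_pre_digraph" and y a
    let ?E = "\<lambda>u v. (u, v) \<in> parcs G"
    assume G: "pair_graph G" and yy: "\<forall>i<N. \<forall>j<N. i \<noteq> j \<longrightarrow> ?E (y i) (y j)"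
      and ya: "\<forall>i<N. ?E (y i) (a i)"
    obtain e where e: "inj_on e {..<m}" "\<forall>i<m. e i < N"
      and hom: "homogeneous m (\<lambda>i j. a (e i) = y (e j))"
        "homogeneous m (\<lambda>i j. a (e j) = y (e i))"
        "homogeneous m (\<lambda>i j. ?E (a (e i)) (y (e j)))"
        "homogeneous m (\<lambda>i j. ?E (a (e j)) (y (e i)))"
        "homogeneous m (\<lambda>i j. ?E (a (e i)) (a (e j)))"
      using N[of "[\<lambda>i j. a i = y j, \<lambda>i j. a j = y i, \<lambda>i j. ?E (a i) (y j), \<lambda>i j. ?E (a j) (y i),
        \<lambda>i j. ?E (a i) (a j)]"] by auto
    define Y A where YA_def: "Y = y \<circ> e" "A = a \<circ> e"
    have YY: "\<forall>i<m. \<forall>j<m. i \<noteq> j \<longrightarrow> ?E (Y i) (Y j)"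
      using yy e unfolding YA_def inj_on_def by (metis comp_apply lessThan_iff)
    have YA: "\<forall>i<m. ?E (Y i) (A i)" using ya e by (simp add: YA_def)
    then have AY: "\<forall>i<m. ?E (A i) (Y i)" using pair_graph_sym[OF G] by blast
    have m3: "0 < m" "1 < m" "2 < m" by (simp_all add: m_def)
    have nm: "n < m" "Suc n < m" by (simp_all add: m_def)
    have Yneq: "Y i \<noteq> Y j" if "i < m" "j < m" "i \<noteq> j" for i j
      using YY that pair_graph_irrefl[OF G] by metis
    \<comment> \<open>An \<open>a i\<close> may itself lie in the clique, so equality is made
      homogeneous too. Were it to hold throughout one order, two distinct \<open>Y\<close> would
      coincide with the same \<open>A\<close>.\<close>
    have AneqY: "\<forall>i<m. \<forall>j<m. i \<noteq> j \<longrightarrow> A i \<noteq> Y j"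
    proof (rule all_distinct_pairsI)
      have "\<not> (\<forall>j<m. \<forall>i<j. A i = Y j)"
      proof (rule notI)
        assume eq: "\<forall>j<m. \<forall>i<j. A i = Y j"
        have "A 0 = Y 1" "A 0 = Y 2" by (rule eq[rule_format]; use m3 in simp)+
        moreover have "Y 1 \<noteq> Y 2" by (rule Yneq) (use m3 in simp_all)
        ultimately show False by metis
      qed
      then show "\<forall>j<m. \<forall>i<j. A i \<noteq> Y j" using hom(1) by (auto simp: homogeneous_def YA_def)
      have "\<not> (\<forall>j<m. \<forall>i<j. A j = Y i)"
      proof (rule notI)
        assume eq: "\<forall>j<m. \<forall>i<j. A j = Y i"
        have "A 2 = Y 0" "A 2 = Y 1" by (rule eq[rule_format]; use m3 in simp)+
        moreover have "Y 0 \<noteq> Y 1" by (rule Yneq) (use m3 in simp_all)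
        ultimately show False by metis
      qed
      then show "\<forall>j<m. \<forall>i<j. A j \<noteq> Y i" using hom(2) by (auto simp: homogeneous_def YA_def)
    qed
    consider (all) "\<forall>j<m. \<forall>i<j. ?E (A i) (Y j)" "\<forall>j<m. \<forall>i<j. ?E (A j) (Y i)"
      | (up) "\<forall>j<m. \<forall>i<j. ?E (A i) (Y j)" "\<forall>j<m. \<forall>i<j. \<not> ?E (A j) (Y i)"
      | (down) "\<forall>j<m. \<forall>i<j. \<not> ?E (A i) (Y j)" "\<forall>j<m. \<forall>i<j. ?E (A j) (Y i)"
      | (none) "\<forall>j<m. \<forall>i<j. \<not> ?E (A i) (Y j)" "\<forall>j<m. \<forall>i<j. \<not> ?E (A j) (Y i)"
      using hom(3,4) unfolding homogeneous_def YA_def comp_def by argo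
    then show "contains_unavoidable n G \<or>
      (\<exists>e. inj_on e {..<l} \<and> (\<forall>i<l. e i < N) \<and> (\<forall>i<l. \<forall>j<l. ?E (a (e i)) (y (e j))))"
    proof cases
      case all
      have AYall: "\<forall>i<m. \<forall>j<m. ?E (A i) (Y j)"
        using all_distinct_pairsI[of m "\<lambda>i j. ?E (A i) (Y j)"] all AY by metis
      have "inj_on e {..<l}" using e(1) by (rule inj_on_subset) (auto simp: m_def)
      then show ?thesis using AYall e(2) by (intro disjI2 exI[of _ e]) (auto simp: m_def YA_def)
    next
      case up
      \<comment> \<open>\<open>A 1\<close> misses \<open>Y 0\<close> but is adjacent to every
        \<open>Y\<close> with index at least 2, as is \<open>Y 0\<close> inside the clique.\<close>
      have "contains_unavoidable n G"
      proof (rule contains_join_edgeless_complete[OF G \<open>n > 0\<close>, of "A 1" "Y 0" "\<lambda>i. Y (i + 2)"])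
        show "A 1 \<noteq> Y 0" "\<not> ?E (A 1) (Y 0)" using AneqY up(2) m3 by auto
        show "\<forall>i<n. ?E (A 1) (Y (i + 2))" using up(1) by (auto simp: m_def)
      qed (use YY in \<open>auto simp: m_def\<close>)
      then show ?thesis ..
    next
      case down
      have "contains_unavoidable n G"
      proof (rule contains_join_edgeless_complete[OF G \<open>n > 0\<close>, of "A n" "Y (Suc n)" Y])
        show "A n \<noteq> Y (Suc n)" "\<not> ?E (A n) (Y (Suc n))" using AneqY down(1) nm by auto
        show "\<forall>i<n. ?E (A n) (Y i)" using down(2) nm by auto
      qed (use YY in \<open>auto simp: m_def\<close>)
      then show ?thesis ..
    next
      case none
      have nAY: "\<forall>i<m. \<forall>j<m. i \<noteq> j \<longrightarrow> \<not> ?E (A i) (Y j)"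
        using all_distinct_pairsI[of m "\<lambda>i j. \<not> ?E (A i) (Y j)"] none by blast
      then have nYA: "\<forall>i<m. \<forall>j<m. i \<noteq> j \<longrightarrow> \<not> ?E (Y i) (A j)"
        using pair_graph_sym[OF G] by metis
      from hom(5) consider (clique) "\<forall>j<m. \<forall>i<j. ?E (A i) (A j)"
        | (indep) "\<forall>j<m. \<forall>i<j. \<not> ?E (A i) (A j)"
        unfolding homogeneous_def YA_def comp_def by argo
      then have "contains_unavoidable n G"
      proof cases
        case clique
        then have AA: "\<forall>i<m. \<forall>j<m. i \<noteq> j \<longrightarrow> ?E (A i) (A j)"
          using all_distinct_pairsI[of m "\<lambda>i j. ?E (A i) (A j)"] pair_graph_sym[OF G] by blast
        show ?thesis
        proof (rule contains_matched_complete_graphs[OF G, of n Y A])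
          show "\<forall>i<n. \<forall>j<n. i \<noteq> j \<longrightarrow> Y i \<noteq> A j \<and> \<not> ?E (Y i) (A j)"
            using AneqY nYA nm(1) by (metis less_trans)
        qed (use YA YY AA in \<open>auto simp: m_def\<close>)
      next
        case indep
        then have AA: "\<forall>i<m. \<forall>j<m. i \<noteq> j \<longrightarrow> \<not> ?E (A i) (A j)"
          using all_distinct_pairsI[of m "\<lambda>i j. \<not> ?E (A i) (A j)"] pair_graph_sym[OF G] by blast
        show ?thesis
          by (rule contains_pendant_complete_graph[OF G, of n Y A])
            (use YA YY AA nYA in \<open>auto simp: m_def\<close>)
      qed
      then show ?thesis ..
    qed
  qed
qed

text \<open>Edges from the \<open>a\<close> or the \<open>b\<close> to the \<open>y\<close> in one
  order of indices give the nested situation. Without them, a clique among the \<open>a\<close> or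
  among the \<open>b\<close> has the \<open>y\<close> as pendants. If both are independent, edges
  between \<open>a\<close> and \<open>b\<close> in one order make \<open>a 0\<close> or
  \<open>b 0\<close> the centre of a new star; with no such edges the triples \<open>a i\<close>,
  \<open>y i\<close>, \<open>b i\<close> are the disjoint paths of
  \<open>K_1 + nP_3\<close>.\<close>

lemma star_with_induced_paths:
  assumes "n > 0"
  shows "\<exists>N::nat. \<forall>(G :: 'a pair_pre_digraph) x y a b. pair_graph G \<longrightarrow> inj_on y {..<N} \<longrightarrow>
    (\<forall>i<N. \<forall>j<N. (y i, y j) \<notin> parcs G) \<longrightarrow>
    (\<forall>i<N. (x, y i) \<in> parcs G \<and> (x, a i) \<in> parcs G \<and> (x, b i) \<in> parcs G) \<longrightarrow>
    (\<forall>i<N. (y i, a i) \<in> parcs G \<and> (y i, b i) \<in> parcs G \<and> a i \<noteq> b i \<and> (a i, b i) \<notin> parcs G) \<longrightarrow>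
    contains_unavoidable n G"
proof -
  obtain M :: nat where M: "\<forall>(G :: 'a pair_pre_digraph) x y z. pair_graph G \<longrightarrow> inj_on y {..<M} \<longrightarrow>
    (\<forall>i<M. (x, y i) \<in> parcs G) \<longrightarrow> (\<forall>i<M. \<forall>j<M. (y i, y j) \<notin> parcs G) \<longrightarrow>
    (\<forall>i<M. (y i, z i) \<in> parcs G \<and> z i \<noteq> x \<and> (x, z i) \<notin> parcs G) \<longrightarrow>
    contains_unavoidable n G"
    using star_with_outer_neighbours[OF assms] ..
  obtain L :: nat where L: "\<forall>(G :: 'a pair_pre_digraph) y a b. pair_graph G \<longrightarrow> inj_on y {..<L} \<longrightarrow>
    (\<forall>i<L. \<forall>j<L. (y i, y j) \<notin> parcs G) \<longrightarrow>
    (\<forall>j<L. \<forall>i\<le>j. (a i, y j) \<in> parcs G) \<longrightarrow>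
    (\<forall>i<L. (y i, b i) \<in> parcs G \<and> a i \<noteq> b i \<and> (a i, b i) \<notin> parcs G) \<longrightarrow>
    contains_unavoidable n G"
    using independent_with_nested_neighbours[OF assms] ..
  define m where "m = Suc M + L + n"
  obtain N where N: "\<And>Rs::(nat \<Rightarrow> nat \<Rightarrow> bool) list. length Rs = 8 \<Longrightarrow>
    \<exists>e. strict_mono_on {..<m} e \<and> inj_on e {..<m} \<and> (\<forall>i<m. e i < N) \<and>
      (\<forall>R\<in>set Rs. homogeneous m (\<lambda>i j. R (e i) (e j)))"
    using homogeneous_subsequence[of 8 m] by blast
  show ?thesis
  proof (intro exI[of _ N] allI impI)
    fix G :: "'a pair_pre_digraph" and x y a b
    let ?E = "\<lambda>u v. (u, v) \<in> parcs G"
    assume G: "pair_graph G" and inj: "inj_on y {..<N}"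
      and yy: "\<forall>i<N. \<forall>j<N. \<not> ?E (y i) (y j)"
      and x: "\<forall>i<N. ?E x (y i) \<and> ?E x (a i) \<and> ?E x (b i)"
      and yab: "\<forall>i<N. ?E (y i) (a i) \<and> ?E (y i) (b i) \<and> a i \<noteq> b i \<and> \<not> ?E (a i) (b i)"
    obtain e where e: "inj_on e {..<m}" "\<forall>i<m. e i < N"
      and hom: "homogeneous m (\<lambda>i j. ?E (a (e i)) (y (e j)))" "homogeneous m (\<lambda>i j. ?E (a (e j)) (y (e i)))"
        "homogeneous m (\<lambda>i j. ?E (b (e i)) (y (e j)))" "homogeneous m (\<lambda>i j. ?E (b (e j)) (y (e i)))"
        "homogeneous m (\<lambda>i j. ?E (a (e i)) (a (e j)))" "homogeneous m (\<lambda>i j. ?E (b (e i)) (b (e j)))"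
        "homogeneous m (\<lambda>i j. ?E (a (e i)) (b (e j)))" "homogeneous m (\<lambda>i j. ?E (a (e j)) (b (e i)))"
      using N[of "[\<lambda>i j. ?E (a i) (y j), \<lambda>i j. ?E (a j) (y i), \<lambda>i j. ?E (b i) (y j), \<lambda>i j. ?E (b j) (y i),
        \<lambda>i j. ?E (a i) (a j), \<lambda>i j. ?E (b i) (b j), \<lambda>i j. ?E (a i) (b j), \<lambda>i j. ?E (a j) (b i)]"] by auto
    define Y A B where YAB_def: "Y = y \<circ> e" "A = a \<circ> e" "B = b \<circ> e"
    have Y: "inj_on Y {..<m}"
      unfolding YAB_def using e inj by (intro comp_inj_on) (auto intro: inj_on_subset)
    have YY: "\<forall>i<m. \<forall>j<m. \<not> ?E (Y i) (Y j)"
      and X: "\<forall>i<m. ?E x (A i) \<and> ?E x (Y i) \<and> ?E x (B i)"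
      and YAB: "\<forall>i<m. ?E (Y i) (A i) \<and> ?E (Y i) (B i) \<and> A i \<noteq> B i \<and> \<not> ?E (A i) (B i)"
      using yy x yab e(2) by (simp_all add: YAB_def)
    have YBA: "\<forall>i<m. ?E (Y i) (B i) \<and> ?E (Y i) (A i) \<and> B i \<noteq> A i \<and> \<not> ?E (B i) (A i)"
      using YAB pair_graph_sym[OF G] by metis

    \<comment> \<open>Stated for arbitrary \<open>P\<close> and \<open>Q\<close> because
      \<open>A\<close> and \<open>B\<close> are interchangeable: \<open>YAB\<close> and
      \<open>YBA\<close> are the two instances.\<close>
    have up: "contains_unavoidable n G"
      if PQ: "\<forall>i<m. ?E (Y i) (P i) \<and> ?E (Y i) (Q i) \<and> P i \<noteq> Q i \<and> \<not> ?E (P i) (Q i)"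
        and PY: "\<forall>j<m. \<forall>i<j. ?E (P i) (Y j)" for P Q
    proof (rule L[rule_format, OF G, where y = Y and a = P and b = Q])
      show "inj_on Y {..<L}" using Y by (rule inj_on_subset) (auto simp: m_def)
      fix i j assume "j < L" "i \<le> j"
      then show "?E (P i) (Y j)"
        using PY PQ pair_graph_sym[OF G] by (cases "i = j") (simp_all add: m_def)
    qed (use YY PQ in \<open>simp_all add: m_def\<close>)
    \<comment> \<open>Sending i to \<open>L - Suc i\<close> reverses the order of the first
      \<open>L\<close> indices and turns this pattern into the nested one.\<close>
    have down: "contains_unavoidable n G"
      if PQ: "\<forall>i<m. ?E (Y i) (P i) \<and> ?E (Y i) (Q i) \<and> P i \<noteq> Q i \<and> \<not> ?E (P i) (Q i)"
        and PY: "\<forall>j<m. \<forall>i<j. ?E (P j) (Y i)" for P Q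
    proof (rule L[rule_format, OF G, where y = "\<lambda>i. Y (L - Suc i)" and a = "\<lambda>i. P (L - Suc i)"
          and b = "\<lambda>i. Q (L - Suc i)"])
      show "inj_on (\<lambda>i. Y (L - Suc i)) {..<L}"
      proof (rule inj_onI)
        fix i j assume ij: "i \<in> {..<L}" "j \<in> {..<L}" "Y (L - Suc i) = Y (L - Suc j)"
        then have "L - Suc i = L - Suc j"
          using inj_onD[OF Y, of "L - Suc i" "L - Suc j"] by (simp add: m_def)
        then show "i = j" using ij by auto
      qed
      fix i j assume "j < L" "i \<le> j"
      then have "L - Suc j = L - Suc i \<or> L - Suc j < L - Suc i" "L - Suc i < m"
        by (auto simp: m_def)
      then show "?E (P (L - Suc i)) (Y (L - Suc j))"
        using PY PQ pair_graph_sym[OF G] by metis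
    qed (use YY PQ in \<open>simp_all add: m_def\<close>)
    consider "\<forall>j<m. \<forall>i<j. ?E (A i) (Y j)" | "\<forall>j<m. \<forall>i<j. ?E (A j) (Y i)"
      | "\<forall>j<m. \<forall>i<j. ?E (B i) (Y j)" | "\<forall>j<m. \<forall>i<j. ?E (B j) (Y i)"
      | (none) "\<forall>j<m. \<forall>i<j. \<not> ?E (A i) (Y j)" "\<forall>j<m. \<forall>i<j. \<not> ?E (A j) (Y i)"
        "\<forall>j<m. \<forall>i<j. \<not> ?E (B i) (Y j)" "\<forall>j<m. \<forall>i<j. \<not> ?E (B j) (Y i)"
      using hom(1-4) unfolding homogeneous_def YAB_def comp_def by argo
    then show "contains_unavoidable n G"
    proof cases
      case none
      have nAY: "\<forall>i<m. \<forall>j<m. i \<noteq> j \<longrightarrow> \<not> ?E (A i) (Y j)"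
        using all_distinct_pairsI[of m "\<lambda>i j. \<not> ?E (A i) (Y j)"] none by blast
      have nBY: "\<forall>i<m. \<forall>j<m. i \<noteq> j \<longrightarrow> \<not> ?E (B i) (Y j)"
        using all_distinct_pairsI[of m "\<lambda>i j. \<not> ?E (B i) (Y j)"] none by blast
      have clique: "contains_unavoidable n G"
        if PY: "\<forall>i<m. ?E (Y i) (P i)" and nPY: "\<forall>i<m. \<forall>j<m. i \<noteq> j \<longrightarrow> \<not> ?E (P i) (Y j)"
          and PP: "\<forall>j<m. \<forall>i<j. ?E (P i) (P j)" for P
      proof -
        have "\<forall>i<m. \<forall>j<m. i \<noteq> j \<longrightarrow> ?E (P i) (P j)"
          using all_distinct_pairsI[of m "\<lambda>i j. ?E (P i) (P j)"] PP pair_graph_sym[OF G] by blast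
        then show ?thesis
          using PY nPY YY pair_graph_sym[OF G]
          by (intro contains_pendant_complete_graph[OF G, of n P Y]) (simp_all add: m_def)
      qed
      \<comment> \<open>\<open>P 0\<close> replaces \<open>x\<close>: the later \<open>Q\<close> are
        its leaves and the corresponding \<open>Y\<close> their outer neighbours. Such a
        \<open>Y\<close> differs from \<open>P 0\<close> because \<open>P 0\<close> is adjacent to
        \<open>Y 0\<close>, and the \<open>Q\<close> are distinct because each sees only its own
        \<open>Y\<close>.\<close>
      have recentre: "contains_unavoidable n G"
        if PY: "\<forall>i<m. ?E (Y i) (P i)" "\<forall>i<m. \<forall>j<m. i \<noteq> j \<longrightarrow> \<not> ?E (P i) (Y j)"
          and QY: "\<forall>i<m. ?E (Y i) (Q i)" "\<forall>i<m. \<forall>j<m. i \<noteq> j \<longrightarrow> \<not> ?E (Q i) (Y j)"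
          and QQ: "\<forall>i<m. \<forall>j<m. \<not> ?E (Q i) (Q j)"
          and PQ: "\<forall>j<m. \<forall>i<j. ?E (P i) (Q j)" for P Q
      proof (rule M[rule_format, OF G, where x = "P 0" and y = "\<lambda>i. Q (Suc i)" and z = "\<lambda>i. Y (Suc i)"])
        show "inj_on (\<lambda>i. Q (Suc i)) {..<M}"
        proof (rule inj_onI)
          fix i j assume ij: "i \<in> {..<M}" "j \<in> {..<M}" "Q (Suc i) = Q (Suc j)"
          then have "?E (Q (Suc i)) (Y (Suc j))" using QY(1) pair_graph_sym[OF G] by (simp add: m_def)
          moreover have "\<not> ?E (Q (Suc i)) (Y (Suc j))" if "i \<noteq> j"
            using ij(1,2) QY(2) that by (simp add: m_def)
          ultimately show "i = j" by blast
        qed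
      next
        fix i assume "i < M"
        then have i: "Suc i < m" "0 < m" by (simp_all add: m_def)
        then have "?E (P 0) (Y 0)" "\<not> ?E (P 0) (Y (Suc i))" "\<not> ?E (Y (Suc i)) (Y 0)"
          using PY YY pair_graph_sym[OF G] by simp_all
        then show "?E (Q (Suc i)) (Y (Suc i)) \<and> Y (Suc i) \<noteq> P 0 \<and> \<not> ?E (P 0) (Y (Suc i))"
          using QY(1) i pair_graph_sym[OF G] by metis
      qed (use PQ QQ in \<open>simp_all add: m_def\<close>)
      consider (1) "\<forall>j<m. \<forall>i<j. ?E (A i) (A j)" | (2) "\<forall>j<m. \<forall>i<j. ?E (B i) (B j)"
        | (3) "\<forall>j<m. \<forall>i<j. \<not> ?E (A i) (A j)" "\<forall>j<m. \<forall>i<j. \<not> ?E (B i) (B j)"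
        using hom(5,6) unfolding homogeneous_def YAB_def comp_def by argo
      then show ?thesis
      proof cases
        case 3
        have "\<forall>i<m. \<forall>j<m. i \<noteq> j \<longrightarrow> \<not> ?E (A i) (A j)" "\<forall>i<m. \<forall>j<m. i \<noteq> j \<longrightarrow> \<not> ?E (B i) (B j)"
          using all_distinct_pairsI[of m "\<lambda>i j. \<not> ?E (A i) (A j)"]
            all_distinct_pairsI[of m "\<lambda>i j. \<not> ?E (B i) (B j)"] 3 pair_graph_sym[OF G] by blast+
        then have AA: "\<forall>i<m. \<forall>j<m. \<not> ?E (A i) (A j)" and BB: "\<forall>i<m. \<forall>j<m. \<not> ?E (B i) (B j)"
          using pair_graph_irrefl[OF G] by metis+
        consider (up) "\<forall>j<m. \<forall>i<j. ?E (A i) (B j)" | (down) "\<forall>j<m. \<forall>i<j. ?E (A j) (B i)"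
          | (none) "\<forall>j<m. \<forall>i<j. \<not> ?E (A i) (B j)" "\<forall>j<m. \<forall>i<j. \<not> ?E (A j) (B i)"
          using hom(7,8) unfolding homogeneous_def YAB_def comp_def by argo
        then show ?thesis
        proof cases
          case up
          then show ?thesis by (intro recentre[of A B]) (use YAB nAY nBY BB in simp_all)
        next
          case down
          then have "\<forall>j<m. \<forall>i<j. ?E (B i) (A j)" using pair_graph_sym[OF G] by blast
          then show ?thesis by (intro recentre[of B A]) (use YAB nAY nBY AA in simp_all)
        next
          case none
          have AB: "\<forall>i<m. \<forall>j<m. i \<noteq> j \<longrightarrow> \<not> ?E (A i) (B j)"
            using all_distinct_pairsI[of m "\<lambda>i j. \<not> ?E (A i) (B j)"] none by blast
          have YA: "\<forall>i<m. \<forall>j<m. i \<noteq> j \<longrightarrow> \<not> ?E (Y i) (A j) \<and> \<not> ?E (Y i) (B j)"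
            using nAY nBY pair_graph_sym[OF G] by metis
          show ?thesis
            by (rule contains_join_copies_path[OF G \<open>n > 0\<close>, of x A Y B])
              (use X YAB AA BB YY AB YA in \<open>simp_all add: m_def\<close>)
        qed
      qed (rule clique[of A] clique[of B]; use YAB nAY nBY in simp)+
    qed (rule up[OF YAB] down[OF YAB] up[OF YBA] down[OF YBA]; assumption)+
  qed
qed

section \<open>Non-simplicial vertices in a clique and around one vertex\<close>

definition nonsimplicial :: "'a pair_pre_digraph \<Rightarrow> 'a \<Rightarrow> bool" where
  "nonsimplicial G v \<longleftrightarrow>
    (\<exists>a b. (v, a) \<in> parcs G \<and> (v, b) \<in> parcs G \<and> a \<noteq> b \<and> (a, b) \<notin> parcs G)"

text \<open>The clique lemma is applied twice: first to the witnesses \<open>a\<close>, keeping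
  \<open>M\<close> indices, then along these to the witnesses \<open>b\<close>, keeping n. If
  neither pass produces one of the seven graphs, both witnesses of one index are adjacent to n
  clique vertices.\<close>

lemma clique_of_nonsimplicial:
  assumes "n > 0"
  shows "\<exists>N::nat. \<forall>(G :: 'a pair_pre_digraph) y. pair_graph G \<longrightarrow>
    (\<forall>i<N. \<forall>j<N. i \<noteq> j \<longrightarrow> (y i, y j) \<in> parcs G) \<longrightarrow> (\<forall>i<N. nonsimplicial G (y i)) \<longrightarrow>
    contains_unavoidable n G"
proof -
  obtain M :: nat where M: "\<forall>(G :: 'a pair_pre_digraph) y a. pair_graph G \<longrightarrow>
    (\<forall>i<M. \<forall>j<M. i \<noteq> j \<longrightarrow> (y i, y j) \<in> parcs G) \<longrightarrow> (\<forall>i<M. (y i, a i) \<in> parcs G) \<longrightarrow>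
    contains_unavoidable n G \<or>
    (\<exists>e. inj_on e {..<n} \<and> (\<forall>i<n. e i < M) \<and> (\<forall>i<n. \<forall>j<n. (a (e i), y (e j)) \<in> parcs G))"
    using clique_with_private_neighbours[OF assms] ..
  obtain N :: nat where N: "\<forall>(G :: 'a pair_pre_digraph) y a. pair_graph G \<longrightarrow>
    (\<forall>i<N. \<forall>j<N. i \<noteq> j \<longrightarrow> (y i, y j) \<in> parcs G) \<longrightarrow> (\<forall>i<N. (y i, a i) \<in> parcs G) \<longrightarrow>
    contains_unavoidable n G \<or>
    (\<exists>e. inj_on e {..<M} \<and> (\<forall>i<M. e i < N) \<and> (\<forall>i<M. \<forall>j<M. (a (e i), y (e j)) \<in> parcs G))"
    using clique_with_private_neighbours[OF assms] ..
  show ?thesis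
  proof (intro exI[of _ N] allI impI)
    fix G :: "'a pair_pre_digraph" and y
    let ?E = "\<lambda>u v. (u, v) \<in> parcs G"
    assume G: "pair_graph G" and yy: "\<forall>i<N. \<forall>j<N. i \<noteq> j \<longrightarrow> ?E (y i) (y j)"
      and "\<forall>i<N. nonsimplicial G (y i)"
    then obtain a b where ya: "\<forall>i<N. ?E (y i) (a i)"
      and yb: "\<forall>i<N. ?E (y i) (b i) \<and> a i \<noteq> b i \<and> \<not> ?E (a i) (b i)"
      unfolding nonsimplicial_def by metis
    show "contains_unavoidable n G"
    proof (rule ccontr)
      assume no: "\<not> contains_unavoidable n G"
      obtain e where e: "inj_on e {..<M}" "\<forall>i<M. e i < N" "\<forall>i<M. \<forall>j<M. ?E (a (e i)) (y (e j))"
        using N[rule_format, OF G, of y a] yy ya no by blast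
      have "\<forall>i<M. \<forall>j<M. i \<noteq> j \<longrightarrow> ?E (y (e i)) (y (e j))"
        using yy e(1,2) unfolding inj_on_def by (metis lessThan_iff)
      then obtain d where d: "inj_on d {..<n}" "\<forall>i<n. d i < M" "\<forall>i<n. \<forall>j<n. ?E (b (e (d i))) (y (e (d j)))"
        using M[rule_format, OF G, of "y \<circ> e" "b \<circ> e"] yb e(2) no by auto
      \<comment> \<open>The two non-adjacent witnesses of the index \<open>e (d 0)\<close> play the
        part of \<open>E_2\<close>.\<close>
      have "contains_unavoidable n G"
      proof (rule contains_join_edgeless_complete[OF G \<open>n > 0\<close>, of "a (e (d 0))" "b (e (d 0))" "\<lambda>i. y (e (d i))"])
        show "\<forall>i<n. \<forall>j<n. i \<noteq> j \<longrightarrow> ?E (y (e (d i))) (y (e (d j)))"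
          using yy e(1,2) d(1,2) unfolding inj_on_def by (metis lessThan_iff)
      qed (use yb e(2,3) d(2,3) \<open>n > 0\<close> in auto)
      then show False using no by simp
    qed
  qed
qed

text \<open>Ramsey's theorem leaves a clique or an independent set of neighbours. Independent ones
  are sorted by whether they have a neighbour outside the closed neighbourhood of \<open>x\<close>,
  which decides between the two star lemmas.\<close>

lemma many_nonsimplicial_neighbours:
  assumes "n > 0"
  shows "\<exists>D::nat. \<forall>(G :: 'a pair_pre_digraph) x. pair_graph G \<longrightarrow>
    D \<le> card {v. (x, v) \<in> parcs G \<and> nonsimplicial G v} \<longrightarrow> contains_unavoidable n G"
proof -
  obtain K :: nat where K: "\<forall>(G :: 'a pair_pre_digraph) y. pair_graph G \<longrightarrow>
    (\<forall>i<K. \<forall>j<K. i \<noteq> j \<longrightarrow> (y i, y j) \<in> parcs G) \<longrightarrow> (\<forall>i<K. nonsimplicial G (y i)) \<longrightarrow>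
    contains_unavoidable n G"
    using clique_of_nonsimplicial[OF assms] ..
  obtain M :: nat where M: "\<forall>(G :: 'a pair_pre_digraph) x y z. pair_graph G \<longrightarrow> inj_on y {..<M} \<longrightarrow>
    (\<forall>i<M. (x, y i) \<in> parcs G) \<longrightarrow> (\<forall>i<M. \<forall>j<M. (y i, y j) \<notin> parcs G) \<longrightarrow>
    (\<forall>i<M. (y i, z i) \<in> parcs G \<and> z i \<noteq> x \<and> (x, z i) \<notin> parcs G) \<longrightarrow>
    contains_unavoidable n G"
    using star_with_outer_neighbours[OF assms] ..
  obtain L :: nat where L: "\<forall>(G :: 'a pair_pre_digraph) x y a b. pair_graph G \<longrightarrow> inj_on y {..<L} \<longrightarrow>
    (\<forall>i<L. \<forall>j<L. (y i, y j) \<notin> parcs G) \<longrightarrow>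
    (\<forall>i<L. (x, y i) \<in> parcs G \<and> (x, a i) \<in> parcs G \<and> (x, b i) \<in> parcs G) \<longrightarrow>
    (\<forall>i<L. (y i, a i) \<in> parcs G \<and> (y i, b i) \<in> parcs G \<and> a i \<noteq> b i \<and> (a i, b i) \<notin> parcs G) \<longrightarrow>
    contains_unavoidable n G"
    using star_with_induced_paths[OF assms] ..
  define m where "m = Suc (K + M + L)"
  obtain N where N: "\<And>Rs::(nat \<Rightarrow> nat \<Rightarrow> bool) list. length Rs = 2 \<Longrightarrow>
    \<exists>e. strict_mono_on {..<m} e \<and> inj_on e {..<m} \<and> (\<forall>i<m. e i < N) \<and>
      (\<forall>R\<in>set Rs. homogeneous m (\<lambda>i j. R (e i) (e j)))"
    using homogeneous_subsequence[of 2 m] by blast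
  show ?thesis
  proof (intro exI[of _ N] allI impI)
    fix G :: "'a pair_pre_digraph" and x
    let ?E = "\<lambda>u v. (u, v) \<in> parcs G"
    let ?S = "{v. ?E x v \<and> nonsimplicial G v}"
    assume G: "pair_graph G" and card: "N \<le> card ?S"
    have "finite ?S"
      by (rule finite_subset[of _ "pverts G"]) (use G in \<open>auto simp: pair_graph_iff\<close>)
    then obtain y where y: "inj_on y {..<N}" "\<forall>i<N. y i \<in> ?S"
      using card_le_inj[of "{..<N}" ?S] card by auto
    \<comment> \<open>A property of one vertex is fed to the Ramsey statement as a relation ignoring
      its second argument. Homogeneity then settles every index but the last, whence the
      \<open>Suc\<close> in \<open>m\<close>.\<close>
    define Q where "Q = (\<lambda>v. \<exists>z. ?E v z \<and> z \<noteq> x \<and> \<not> ?E x z)"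
    obtain e where e: "inj_on e {..<m}" "\<forall>i<m. e i < N"
      and hom: "homogeneous m (\<lambda>i j. ?E (y (e i)) (y (e j)))" "homogeneous m (\<lambda>i j. Q (y (e i)))"
      using N[of "[\<lambda>i j. ?E (y i) (y j), \<lambda>i j. Q (y i)]"] by auto
    define Y where "Y = y \<circ> e"
    have Y: "inj_on Y {..<m}"
      unfolding Y_def using e y(1) by (intro comp_inj_on) (auto intro: inj_on_subset)
    have xY: "\<forall>i<m. ?E x (Y i)" and ns: "\<forall>i<m. nonsimplicial G (Y i)"
      using y(2) e(2) by (simp_all add: Y_def)
    from hom(1) consider (clique) "\<forall>j<m. \<forall>i<j. ?E (Y i) (Y j)" | (indep) "\<forall>j<m. \<forall>i<j. \<not> ?E (Y i) (Y j)"
      unfolding homogeneous_def Y_def comp_def by argo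
    then show "contains_unavoidable n G"
    proof cases
      case clique
      then have "\<forall>i<m. \<forall>j<m. i \<noteq> j \<longrightarrow> ?E (Y i) (Y j)"
        using all_distinct_pairsI[of m "\<lambda>i j. ?E (Y i) (Y j)"] pair_graph_sym[OF G] by blast
      then show ?thesis using ns by (intro K[rule_format, OF G, of Y]) (simp_all add: m_def)
    next
      case indep
      then have "\<forall>i<m. \<forall>j<m. i \<noteq> j \<longrightarrow> \<not> ?E (Y i) (Y j)"
        using all_distinct_pairsI[of m "\<lambda>i j. \<not> ?E (Y i) (Y j)"] pair_graph_sym[OF G] by blast
      then have YY: "\<forall>i<m. \<forall>j<m. \<not> ?E (Y i) (Y j)" using pair_graph_irrefl[OF G] by metis
      from hom(2) consider (outer) "\<forall>j<m. \<forall>i<j. Q (Y i)" | (inner) "\<forall>j<m. \<forall>i<j. \<not> Q (Y i)"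
        unfolding homogeneous_def Y_def comp_def by argo
      then show ?thesis
      proof cases
        case outer
        have "\<forall>i<M. Q (Y i)"
          by (intro allI impI outer[rule_format, of "m - 1"]) (simp_all add: m_def)
        then obtain z where z: "\<forall>i<M. ?E (Y i) (z i) \<and> z i \<noteq> x \<and> \<not> ?E x (z i)"
          unfolding Q_def by metis
        show ?thesis
        proof (rule M[rule_format, OF G, where x = x and y = Y and z = z])
          show "inj_on Y {..<M}" using Y by (rule inj_on_subset) (auto simp: m_def)
        qed (use xY YY z in \<open>simp_all add: m_def\<close>)
      next
        case inner
        have nQ: "\<forall>i<L. \<not> Q (Y i)"
          by (intro allI impI inner[rule_format, of "m - 1"]) (simp_all add: m_def)
        have "\<forall>i<L. nonsimplicial G (Y i)" using ns by (simp add: m_def)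
        then obtain a b where ab: "\<forall>i<L. ?E (Y i) (a i) \<and> ?E (Y i) (b i) \<and> a i \<noteq> b i \<and> \<not> ?E (a i) (b i)"
          unfolding nonsimplicial_def by metis
        \<comment> \<open>Neither witness is \<open>x\<close>: the other one would then, by
          \<open>nQ\<close>, be a neighbour of \<open>x\<close>, against the non-adjacency of the
          two.\<close>
        then have xab: "\<forall>i<L. ?E x (a i) \<and> ?E x (b i)"
          using nQ pair_graph_sym[OF G] unfolding Q_def by metis
        show ?thesis
        proof (rule L[rule_format, OF G, where x = x and y = Y and a = a and b = b])
          show "inj_on Y {..<L}" using Y by (rule inj_on_subset) (auto simp: m_def)
        qed (use xY xab YY ab in \<open>simp_all add: m_def\<close>)
      qed
    qed
  qed
qed

section \<open>Distance layers\<close>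

lemma rtrancl_on_eq_rtrancl:
  assumes "E \<subseteq> V \<times> V" "u \<in> V"
  shows "(u, v) \<in> rtrancl_on V E \<longleftrightarrow> (u, v) \<in> E\<^sup>*"
proof
  assume "(u, v) \<in> E\<^sup>*"
  then show "(u, v) \<in> rtrancl_on V E"
    by (induction rule: rtrancl_induct) (use assms in \<open>auto intro: rtrancl_on_into_rtrancl_on\<close>)
qed (rule rtrancl_on_rtranclI)

text \<open>Connectedness is strong connectedness of the symmetric closure, and the arcs are
  symmetric already.\<close>

lemma connected_iff_rtrancl:
  assumes "pair_graph G"
  shows "Digraph_Component.connected (with_proj G) \<longleftrightarrow>
    pverts G \<noteq> {} \<and> (\<forall>u\<in>pverts G. \<forall>v\<in>pverts G. (u, v) \<in> (parcs G)\<^sup>*)"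
proof -
  have "parcs (mk_symmetric (with_proj G)) = parcs G"
    using pair_graph_sym[OF assms] by (auto simp: parcs_mk_symmetric)
  moreover have "parcs G \<subseteq> pverts G \<times> pverts G" using assms by (simp add: pair_graph_iff)
  ultimately show ?thesis
    by (simp add: Digraph_Component.connected_def strongly_connected_def reachable_def
        rtrancl_on_eq_rtrancl)
qed

text \<open>Unspecified when \<open>v\<close> is not reachable from \<open>r\<close>, since
  \<open>LEAST\<close> then has no candidate; hence the reachability hypotheses below.\<close>

definition distance :: "('a \<times> 'a) set \<Rightarrow> 'a \<Rightarrow> 'a \<Rightarrow> nat" where
  "distance E r v = (LEAST k. (r, v) \<in> E ^^ k)"

lemma relpow_distance: "(r, v) \<in> E\<^sup>* \<Longrightarrow> (r, v) \<in> E ^^ distance E r v"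
  unfolding distance_def by (rule LeastI_ex) (auto simp: rtrancl_power)

lemma distance_le: "(r, v) \<in> E ^^ k \<Longrightarrow> distance E r v \<le> k"
  unfolding distance_def by (rule Least_le)

lemma distance_eq_0: "(r, v) \<in> E\<^sup>* \<Longrightarrow> distance E r v = 0 \<Longrightarrow> v = r"
  using relpow_distance[of r v E] by simp

lemma distance_step:
  assumes "(r, u) \<in> E\<^sup>*" "(u, v) \<in> E"
  shows "distance E r v \<le> Suc (distance E r u)"
  using relpow_distance[OF assms(1)] assms(2) by (intro distance_le) auto

text \<open>The last vertex before \<open>v\<close> on a shortest walk has distance at most k by
  that walk, and at least k because one edge raises the distance by at most one.\<close>

lemma distance_pred:
  assumes "(r, v) \<in> E\<^sup>*" "distance E r v = Suc k"
  obtains u where "(u, v) \<in> E" "(r, u) \<in> E\<^sup>*" "distance E r u = k"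
proof -
  obtain u where u: "(r, u) \<in> E ^^ k" "(u, v) \<in> E"
    using relpow_distance[OF assms(1)] unfolding assms(2) by auto
  then have "(r, u) \<in> E\<^sup>*" by (meson relpow_imp_rtrancl)
  moreover from this have "distance E r u = k"
    using distance_le[OF u(1)] distance_step[OF _ u(2)] assms(2) by fastforce
  ultimately show thesis using that u(2) by blast
qed

lemma geodesic:
  assumes "(r, v) \<in> E\<^sup>*" "distance E r v = k"
  shows "\<exists>p. p k = v \<and> (\<forall>i\<le>k. (r, p i) \<in> E\<^sup>* \<and> distance E r (p i) = i) \<and> (\<forall>i<k. (p i, p (Suc i)) \<in> E)"
  using assms
proof (induction k arbitrary: v)
  case 0
  then show ?case by (intro exI[of _ "\<lambda>_. v"]) auto
next
  case (Suc k)
  then obtain u where u: "(u, v) \<in> E" "(r, u) \<in> E\<^sup>*" "distance E r u = k"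
    using distance_pred by metis
  then obtain p where "p k = u" "\<forall>i\<le>k. (r, p i) \<in> E\<^sup>* \<and> distance E r (p i) = i"
    "\<forall>i<k. (p i, p (Suc i)) \<in> E"
    using Suc.IH by blast
  then show ?case
    using Suc.prems u(1) by (intro exI[of _ "p(Suc k := v)"]) (auto simp: le_Suc_eq less_Suc_eq)
qed

text \<open>A geodesic to \<open>v\<close> has one vertex more than its length. Its vertices are
  told apart by their distances, and it is induced because adjacent vertices differ by at most one
  in distance.\<close>

lemma contains_path_graph:
  assumes G: "pair_graph G" and r: "r \<in> pverts G" and v: "(r, v) \<in> (parcs G)\<^sup>*"
    and far: "n \<le> Suc (distance (parcs G) r v)"
  shows "contains_unavoidable n G"
proof -
  let ?d = "distance (parcs G) r"
  obtain p where p: "\<forall>i\<le>?d v. (r, p i) \<in> (parcs G)\<^sup>* \<and> ?d (p i) = i"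
    "\<forall>i<?d v. (p i, p (Suc i)) \<in> parcs G"
    using geodesic[OF v refl] by blast
  have *: "i \<le> ?d v" if "i < n" for i using that far by simp
  have "path_graph n \<le>\<^sub>i\<^sub>n\<^sub>d G"
  proof (rule induced_leI[OF pair_graph_path_graph G, where f = p])
    show "inj_on p (pverts (path_graph n))"
      using p(1) * by (intro inj_onI) (metis path_graph_simps(1) lessThan_iff)
  next
    fix i assume "i \<in> pverts (path_graph n)"
    then have "(r, p i) \<in> (parcs G)\<^sup>*" using p(1) * by (simp add: path_graph_simps)
    then show "p i \<in> pverts G"
      using r by (cases rule: rtranclE) (auto intro: pair_graph_verts[OF G])
  next
    fix i j assume "i \<in> pverts (path_graph n)" "j \<in> pverts (path_graph n)"
    then have ij: "i < n" "j < n" by (simp_all add: path_graph_simps)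
    show "(i, j) \<in> parcs (path_graph n) \<longleftrightarrow> (p i, p j) \<in> parcs G"
    proof
      assume "(i, j) \<in> parcs (path_graph n)"
      then have "j = Suc i \<or> i = Suc j" by (simp add: path_graph_simps)
      then show "(p i, p j) \<in> parcs G"
        using p(2) ij *[OF ij(1)] *[OF ij(2)] pair_graph_sym[OF G] by (metis Suc_le_lessD)
    next
      assume E: "(p i, p j) \<in> parcs G"
      then have "j \<le> Suc i" "i \<le> Suc j" "i \<noteq> j"
        using p(1) *[OF ij(1)] *[OF ij(2)] distance_step pair_graph_sym[OF G] pair_graph_irrefl[OF G]
        by metis+
      then show "(i, j) \<in> parcs (path_graph n)" using ij by (auto simp: path_graph_simps)
    qed
  qed
  then show ?thesis by (auto simp: contains_unavoidable_def unavoidable_def)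
qed

text \<open>
  Inner vertices of geodesics are not simplicial, so every non-simplicial vertex of a layer has
  a non-simplicial neighbour, or the root, in the layer before.
\<close>

lemma many_nonsimplicial:
  assumes "n > 0"
  shows "\<exists>C::nat. \<forall>G :: 'a pair_pre_digraph. pair_graph G \<longrightarrow>
    Digraph_Component.connected (with_proj G) \<longrightarrow>
    C < card {v \<in> pverts G. nonsimplicial G v} \<longrightarrow> contains_unavoidable n G"
proof -
  obtain D :: nat where D: "\<forall>(G :: 'a pair_pre_digraph) x. pair_graph G \<longrightarrow>
    D \<le> card {v. (x, v) \<in> parcs G \<and> nonsimplicial G v} \<longrightarrow> contains_unavoidable n G"
    using many_nonsimplicial_neighbours[OF assms] ..
  show ?thesis
  \<comment> \<open>Layer k contributes at most \<open>D ^ k\<close> vertices, and excluding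
    \<open>P_n\<close> leaves only the layers k < n.\<close>
  proof (intro exI[of _ "\<Sum>k<n. D ^ k"] allI impI, rule ccontr)
    fix G :: "'a pair_pre_digraph"
    assume G: "pair_graph G" and conn: "Digraph_Component.connected (with_proj G)"
      and large: "(\<Sum>k<n. D ^ k) < card {v \<in> pverts G. nonsimplicial G v}"
      and no: "\<not> contains_unavoidable n G"
    obtain r where r: "r \<in> pverts G" and reach: "\<And>v. v \<in> pverts G \<Longrightarrow> (r, v) \<in> (parcs G)\<^sup>*"
      using conn unfolding connected_iff_rtrancl[OF G] by blast
    let ?d = "distance (parcs G) r"
    \<comment> \<open>The root is kept even if it is simplicial, so that layer 1 is still covered by
      neighbourhoods of members of layer 0.\<close>
    define S where "S = (\<lambda>k. {v \<in> pverts G. ?d v = k \<and> (k = 0 \<or> nonsimplicial G v)})"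
    define W where "W = (\<lambda>u. {v. (u, v) \<in> parcs G \<and> nonsimplicial G v})"
    have finV: "finite (pverts G)" using G by (simp add: pair_graph_iff)
    have finS: "finite (S k)" for k using finV by (simp add: S_def)
    have WD: "card (W u) \<le> D" for u
      using D[rule_format, OF G, of u] no unfolding W_def by force
    have finW: "finite (W u)" for u
      by (rule finite_subset[OF _ finV]) (auto simp: W_def intro: pair_graph_verts[OF G])
    have step: "S (Suc k) \<subseteq> (\<Union>u\<in>S k. W u)" for k
    proof
      fix v assume "v \<in> S (Suc k)"
      then have v: "v \<in> pverts G" "?d v = Suc k" "nonsimplicial G v" by (auto simp: S_def)
      obtain u where u: "(u, v) \<in> parcs G" "(r, u) \<in> (parcs G)\<^sup>*" "?d u = k"
        using distance_pred[OF reach[OF v(1)] v(2)] .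
      have "nonsimplicial G u" if "k \<noteq> 0"
      proof -
        obtain l where l: "k = Suc l" using \<open>k \<noteq> 0\<close> by (auto simp: gr0_conv_Suc)
        obtain t where t: "(t, u) \<in> parcs G" "(r, t) \<in> (parcs G)\<^sup>*" "?d t = l"
          using distance_pred[OF u(2), of l] u(3) l by metis
        \<comment> \<open>The distances of \<open>t\<close> and \<open>v\<close> differ by two, so
          \<open>t\<close>, \<open>u\<close>, \<open>v\<close> is an induced path with centre
          \<open>u\<close>.\<close>
        have "t \<noteq> v" "(t, v) \<notin> parcs G"
          using distance_step[OF t(2), of v] t(3) v(2) l by auto
        then show ?thesis
          using u(1) pair_graph_sym[OF G t(1)] unfolding nonsimplicial_def by blast
      qed
      then have "u \<in> S k" using u pair_graph_verts[OF G] by (auto simp: S_def)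
      then show "v \<in> (\<Union>u\<in>S k. W u)" using u(1) v(3) by (auto simp: W_def)
    qed
    have cardS: "card (S k) \<le> D ^ k" for k
    proof (induction k)
      case 0
      have "S 0 \<subseteq> {r}" using distance_eq_0 reach by (fastforce simp: S_def)
      then show ?case using card_mono[of "{r}" "S 0"] by simp
    next
      case (Suc k)
      have "card (S (Suc k)) \<le> card (\<Union>u\<in>S k. W u)"
        using finS finW by (intro card_mono step) auto
      also have "\<dots> \<le> (\<Sum>u\<in>S k. card (W u))" by (rule card_UN_le[OF finS])
      also have "\<dots> \<le> card (S k) * D" using sum_bounded_above[of "S k" "\<lambda>u. card (W u)" D] WD by simp
      also have "\<dots> \<le> D ^ k * D" using Suc by simp
      finally show ?case by (simp add: mult.commute)
    qed
    have "{v \<in> pverts G. nonsimplicial G v} \<subseteq> (\<Union>k<n. S k)"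
    proof
      fix v assume "v \<in> {v \<in> pverts G. nonsimplicial G v}"
      then have v: "v \<in> pverts G" "nonsimplicial G v" by auto
      then have "?d v < n" using contains_path_graph[OF G r reach[OF v(1)], of n] no by fastforce
      then show "v \<in> (\<Union>k<n. S k)" using v by (auto simp: S_def)
    qed
    then have "card {v \<in> pverts G. nonsimplicial G v} \<le> card (\<Union>k<n. S k)"
      using finS by (intro card_mono) auto
    also have "\<dots> \<le> (\<Sum>k<n. card (S k))" by (rule card_UN_le) simp
    also have "\<dots> \<le> (\<Sum>k<n. D ^ k)" by (intro sum_mono cardS)
    finally show False using large by simp
  qed
qed

section \<open>The seven graphs have many non-simplicial vertices\<close>

text \<open>The empty set is independent, so the maximum is over a finite nonempty set and is at
  least 2 iff some independent set has two members; these are the witnesses.\<close>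

lemma independence_number_neighbourhood:
  assumes G: "pair_graph G"
  shows "\<alpha> G (neighbourhood G v) \<ge> 2 \<longleftrightarrow> nonsimplicial G v"
proof -
  let ?S = "neighbourhood G v"
  have S: "?S \<subseteq> pverts G" by (auto simp: neighbourhood_def intro: pair_graph_verts[OF G])
  then have fin: "finite ?S" using G by (auto simp: pair_graph_iff intro: finite_subset)
  have ind: "independent (with_proj G \<restriction> ?S) I \<longleftrightarrow> I \<subseteq> ?S \<and> (\<forall>a\<in>I. \<forall>b\<in>I. (a, b) \<notin> parcs G)" for I
    by (auto simp: independent_def induce_subgraph_def arcs_ends_conv)
  have "finite {I. independent (with_proj G \<restriction> ?S) I}"
    by (rule finite_subset[of _ "Pow ?S"]) (auto simp: ind fin)
  moreover have "{} \<in> {I. independent (with_proj G \<restriction> ?S) I}" by (simp add: ind)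
  ultimately have "\<alpha> G ?S \<ge> 2 \<longleftrightarrow> (\<exists>I. independent (with_proj G \<restriction> ?S) I \<and> card I \<ge> 2)"
    unfolding \<alpha>_def independence_number_def by (subst Max_ge_iff) auto
  also have "\<dots> \<longleftrightarrow> nonsimplicial G v"
  proof
    assume "\<exists>I. independent (with_proj G \<restriction> ?S) I \<and> card I \<ge> 2"
    then obtain I where I: "I \<subseteq> ?S" "\<forall>a\<in>I. \<forall>b\<in>I. (a, b) \<notin> parcs G" "card I \<ge> 2" by (auto simp: ind)
    then have "finite I" using fin finite_subset by blast
    then obtain a b where "a \<in> I" "b \<in> I" "a \<noteq> b"
      using I(3) card_le_Suc0_iff_eq[of I] by fastforce
    then show "nonsimplicial G v"
      using I unfolding nonsimplicial_def neighbourhood_def by blast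
  next
    assume "nonsimplicial G v"
    then obtain a b where ab: "(v, a) \<in> parcs G" "(v, b) \<in> parcs G" "a \<noteq> b" "(a, b) \<notin> parcs G"
      unfolding nonsimplicial_def by blast
    then have "independent (with_proj G \<restriction> ?S) {a, b}"
      unfolding ind using pair_graph_sym[OF G] pair_graph_irrefl[OF G] by (auto simp: neighbourhood_def)
    then show "\<exists>I. independent (with_proj G \<restriction> ?S) I \<and> card I \<ge> 2"
      using ab(3) by (intro exI[of _ "{a, b}"]) simp
  qed
  finally show ?thesis .
qed

section \<open>Connectedness of the seven graphs\<close>

lemma connectedI:
  assumes G: "pair_graph G" and "r \<in> pverts G" "\<And>v. v \<in> pverts G \<Longrightarrow> (r, v) \<in> (parcs G)\<^sup>*"
  shows "Digraph_Component.connected (with_proj G)"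
proof -
  have "sym ((parcs G)\<^sup>*)" using G by (simp add: pair_graph_iff sym_rtrancl)
  then show ?thesis
    unfolding connected_iff_rtrancl[OF G] using assms(2,3) by (metis empty_iff rtrancl_trans symD)
qed

text \<open>The criterion for all of the seven graphs but the path: each has a vertex within
  distance two of every other.\<close>

lemma connected_radius_two:
  assumes "pair_graph G" "r \<in> pverts G"
    and "\<forall>v\<in>pverts G. v = r \<or> (r, v) \<in> parcs G \<or> (\<exists>u. (r, u) \<in> parcs G \<and> (u, v) \<in> parcs G)"
  shows "Digraph_Component.connected (with_proj G)"
  using assms by (intro connectedI[of G r]) (auto intro: rtrancl_into_rtrancl)

text \<open>For n = 0 this fails: the path is then the null graph, and \<open>K_{2,0}\<close>
  consists of two isolated vertices.\<close>

lemma connected_unavoidable: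
  assumes "n > 0" "H \<in> unavoidable n"
  shows "Digraph_Component.connected (with_proj H)"
proof -
  consider "H = pendant_complete_graph n" | "H = path_graph n" | "H = pendant_star n"
    | "H = complete_bipartite_graph 2 n" | "H = join (edgeless_graph 2) (complete_graph n)"
    | "H = join (complete_graph 1) (copies n (path_graph 3))" | "H = matched_complete_graphs n"
    using assms(2) by (auto simp: unavoidable_def)
  then show ?thesis
  proof cases
    case 1
    show ?thesis
    proof (rule connected_radius_two[of _ "inl 0"])
      have "\<exists>u. (inl 0, u) \<in> parcs H \<and> (u, inr i) \<in> parcs H" if "i \<noteq> 0" "i < n" for i
        using that by (intro exI[of _ "inl i"]) (simp add: 1 pendant_complete_graph_def construction_simps)
      moreover have "pverts H = inl ` {..<n} \<union> inr ` {..<n}"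
        "(inl 0, inr 0) \<in> parcs H" "\<And>i. i < n \<Longrightarrow> i \<noteq> 0 \<Longrightarrow> (inl 0, inl i) \<in> parcs H"
        using \<open>n > 0\<close> by (simp_all add: 1 pendant_complete_graph_def construction_simps)
      ultimately show "\<forall>v\<in>pverts H. v = inl 0 \<or> (inl 0, v) \<in> parcs H \<or>
          (\<exists>u. (inl 0, u) \<in> parcs H \<and> (u, v) \<in> parcs H)"
        by (metis (no_types, lifting) UnE imageE lessThan_iff)
    qed (use 1 \<open>n > 0\<close> pair_graph_unavoidable[OF assms(2)] in
        \<open>auto simp: pendant_complete_graph_def construction_simps\<close>)
  next
    case 2
    show ?thesis
    proof (rule connectedI[of _ 0])
      fix v assume "v \<in> pverts H"
      then have "v < n" by (simp add: 2 path_graph_simps)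
      then show "(0, v) \<in> (parcs H)\<^sup>*"
      proof (induction v)
        case (Suc v)
        then have "(v, Suc v) \<in> parcs H" by (simp add: 2 path_graph_simps)
        then show ?case using Suc by (auto intro: rtrancl_into_rtrancl)
      qed simp
    qed (use 2 \<open>n > 0\<close> pair_graph_unavoidable[OF assms(2)] in \<open>auto simp: path_graph_simps\<close>)
  next
    case 3
    show ?thesis
    proof (rule connected_radius_two[of _ "inl (inl 0)"])
      have "(\<exists>u. (inl (inl 0), u) \<in> parcs H \<and> (u, inr (inr i)) \<in> parcs H)" if "i < n" for i
        using that by (intro exI[of _ "inl (inr i)"]) (simp add: 3 pendant_star_def construction_simps)
      then show "\<forall>v\<in>pverts H. v = inl (inl 0) \<or> (inl (inl 0), v) \<in> parcs H \<or>
          (\<exists>u. (inl (inl 0), u) \<in> parcs H \<and> (u, v) \<in> parcs H)"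
        using \<open>n > 0\<close> by (auto simp: 3 pendant_star_def construction_simps)
    qed (use 3 \<open>n > 0\<close> pair_graph_unavoidable[OF assms(2)] in
        \<open>auto simp: pendant_star_def construction_simps\<close>)
  next
    case 4
    show ?thesis
    proof (rule connected_radius_two[of _ "inl 0"])
      have "(\<exists>u. (inl 0, u) \<in> parcs H \<and> (u, inl i) \<in> parcs H)" if "i < 2" for i
        using that \<open>n > 0\<close> by (intro exI[of _ "inr 0"]) (simp add: 4 construction_simps)
      then show "\<forall>v\<in>pverts H. v = inl 0 \<or> (inl 0, v) \<in> parcs H \<or>
          (\<exists>u. (inl 0, u) \<in> parcs H \<and> (u, v) \<in> parcs H)"
        using \<open>n > 0\<close> by (auto simp: 4 construction_simps)
    qed (use 4 \<open>n > 0\<close> pair_graph_unavoidable[OF assms(2)] in \<open>auto simp: construction_simps\<close>)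
  next
    case 5
    show ?thesis
    proof (rule connected_radius_two[of _ "inl 0"])
      have "(\<exists>u. (inl 0, u) \<in> parcs H \<and> (u, inl i) \<in> parcs H)" if "i < 2" for i
        using that \<open>n > 0\<close> by (intro exI[of _ "inr 0"]) (simp add: 5 construction_simps)
      then show "\<forall>v\<in>pverts H. v = inl 0 \<or> (inl 0, v) \<in> parcs H \<or>
          (\<exists>u. (inl 0, u) \<in> parcs H \<and> (u, v) \<in> parcs H)"
        using \<open>n > 0\<close> by (auto simp: 5 construction_simps)
    qed (use 5 \<open>n > 0\<close> pair_graph_unavoidable[OF assms(2)] in \<open>auto simp: construction_simps\<close>)
  next
    case 6
    then show ?thesis
      by (intro connected_radius_two[of _ "inl 0"] pair_graph_unavoidable[OF assms(2)])
        (auto simp: construction_simps)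
  next
    case 7
    show ?thesis
    proof (rule connected_radius_two[of _ "prod_encode (0, 0)"])
      have "prod_encode (k, i) = prod_encode (0, 0) \<or> (prod_encode (0, 0), prod_encode (k, i)) \<in> parcs H \<or>
          (\<exists>u. (prod_encode (0, 0), u) \<in> parcs H \<and> (u, prod_encode (k, i)) \<in> parcs H)"
        if "k < 2" "i < n" for k i
      \<comment> \<open>Everything in copy 0 or with index 0 is within distance one of the root; the
        rest is reached through the matched partner in copy 0.\<close>
      proof (cases "i = 0 \<or> k = 0")
        case False
        then show ?thesis
          using that by (intro disjI2 exI[of _ "prod_encode (0, i)"]) (simp add: 7 construction_simps)
      qed (use that in \<open>auto simp: 7 construction_simps\<close>)
      then show "\<forall>v\<in>pverts H. v = prod_encode (0, 0) \<or> (prod_encode (0, 0), v) \<in> parcs H \<or>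
          (\<exists>u. (prod_encode (0, 0), u) \<in> parcs H \<and> (u, v) \<in> parcs H)"
        by (auto simp: 7 matched_complete_graphs_simps(1))
    qed (use 7 \<open>n > 0\<close> pair_graph_unavoidable[OF assms(2)] in
        \<open>auto simp: construction_simps\<close>)
  qed
qed

section \<open>Counting the non-simplicial vertices of the seven graphs\<close>

lemma nonsimplicialI:
  "(v, a) \<in> parcs G \<Longrightarrow> (v, b) \<in> parcs G \<Longrightarrow> a \<noteq> b \<Longrightarrow> (a, b) \<notin> parcs G \<Longrightarrow> nonsimplicial G v"
  unfolding nonsimplicial_def by blast

text \<open>The deficit of two is that of the path, whose ends are simplicial. It also leaves the
  vertex \<open>n - 1\<close> free to serve as a neighbour of the counted clique vertices in
  \<open>K_n^*\<close> and \<open>CK_n\<close>. Adding 2 on the right avoids truncated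
  subtraction.\<close>

lemma card_nonsimplicial_unavoidable:
  assumes "H \<in> unavoidable n"
  shows "n \<le> card {v \<in> pverts H. nonsimplicial H v} + 2"
proof -
  have many: "n \<le> card {v \<in> pverts H. nonsimplicial H v} + 2"
    if "inj f" "\<And>i. i < n - 2 \<Longrightarrow> nonsimplicial H (f i)" for f :: "nat \<Rightarrow> nat"
  proof -
    have "f ` {..<n - 2} \<subseteq> {v \<in> pverts H. nonsimplicial H v}"
      using that(2) pair_graph_verts[OF pair_graph_unavoidable[OF assms]]
      by (auto simp: nonsimplicial_def)
    moreover have "finite (pverts H)"
      using pair_graph_unavoidable[OF assms] by (simp add: pair_graph_iff)
    ultimately have "card (f ` {..<n - 2}) \<le> card {v \<in> pverts H. nonsimplicial H v}"
      by (intro card_mono) auto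
    moreover have "card (f ` {..<n - 2}) = n - 2"
      using that(1) by (simp add: card_image inj_on_subset)
    ultimately show ?thesis by simp
  qed
  consider "H = pendant_complete_graph n" | "H = path_graph n" | "H = pendant_star n"
    | "H = complete_bipartite_graph 2 n" | "H = join (edgeless_graph 2) (complete_graph n)"
    | "H = join (complete_graph 1) (copies n (path_graph 3))" | "H = matched_complete_graphs n"
    using assms by (auto simp: unavoidable_def)
  then show ?thesis
  proof cases
    case 1
    show ?thesis
      by (rule many[of inl], simp add: inj_def sum_encode_eq,
          rule_tac a = "inr i" and b = "inl (n - 1)" in nonsimplicialI)
        (auto simp: 1 pendant_complete_graph_def construction_simps)
  next
    case 2
    show ?thesis
      by (rule many[of Suc], simp, rule_tac a = i and b = "Suc (Suc i)" in nonsimplicialI)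
        (auto simp: 2 construction_simps)
  next
    case 3
    show ?thesis
      by (rule many[of "\<lambda>i. inl (inr i)"], simp add: inj_def sum_encode_eq,
          rule_tac a = "inl (inl 0)" and b = "inr (inr i)" in nonsimplicialI)
        (auto simp: 3 pendant_star_def construction_simps)
  next
    case 4
    show ?thesis
      by (rule many[of inr], simp add: inj_def sum_encode_eq,
          rule_tac a = "inl 0" and b = "inl 1" in nonsimplicialI)
        (auto simp: 4 construction_simps)
  next
    case 5
    show ?thesis
      by (rule many[of inr], simp add: inj_def sum_encode_eq,
          rule_tac a = "inl 0" and b = "inl 1" in nonsimplicialI)
        (auto simp: 5 construction_simps)
  next
    case 6
    show ?thesis
      by (rule many[of "\<lambda>i. inr (prod_encode (i, 1))"], simp add: inj_def sum_encode_eq prod_encode_eq,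
          rule_tac a = "inr (prod_encode (i, 0))" and b = "inr (prod_encode (i, 2))" in nonsimplicialI)
        (auto simp: 6 construction_simps)
  next
    case 7
    show ?thesis
      by (rule many[of "\<lambda>i. prod_encode (0, i)"], simp add: inj_def prod_encode_eq,
          rule_tac a = "prod_encode (1, i)" and b = "prod_encode (0, n - 1)" in nonsimplicialI)
        (auto simp: 7 construction_simps)
  qed
qed

section \<open>The two directions of the equivalence\<close>

theorem theorem1p4:
  fixes \<H> :: "'a pair_pre_digraph set"
  assumes "\<forall>H\<in>\<H>. pair_graph H"
  shows "(\<exists>C::nat. \<forall>G::nat pair_pre_digraph.
            pair_graph G \<and> Digraph_Component.connected (with_proj G) \<and> family_free \<H> G \<longrightarrow>
            card {v \<in> pverts G. \<alpha> G (neighbourhood G v) \<ge> 2} \<le> C) \<longleftrightarrow>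
         (\<exists>n::nat. n > 0 \<and>
            \<H> \<le>\<^sub>f\<^sub>a\<^sub>m
              {pendant_complete_graph n,
               path_graph n,
               pendant_star n,
               complete_bipartite_graph 2 n,
               join (edgeless_graph 2) (complete_graph n),
               join (complete_graph 1) (copies n (path_graph 3)),
               matched_complete_graphs n})"
proof -
  have card_eq: "{v \<in> pverts G. \<alpha> G (neighbourhood G v) \<ge> 2} = {v \<in> pverts G. nonsimplicial G v}"
    if "pair_graph G" for G :: "nat pair_pre_digraph"
    using independence_number_neighbourhood[OF that] by blast
  show ?thesis
    unfolding unavoidable_def[symmetric]
  proof
    assume "\<exists>C::nat. \<forall>G::nat pair_pre_digraph.
      pair_graph G \<and> Digraph_Component.connected (with_proj G) \<and> family_free \<H> G \<longrightarrow>
      card {v \<in> pverts G. \<alpha> G (neighbourhood G v) \<ge> 2} \<le> C"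
    then obtain C :: nat where C: "\<And>G::nat pair_pre_digraph. pair_graph G \<Longrightarrow>
      Digraph_Component.connected (with_proj G) \<Longrightarrow> family_free \<H> G \<Longrightarrow>
      card {v \<in> pverts G. nonsimplicial G v} \<le> C"
      using card_eq by metis
    \<comment> \<open>With n = C + 3 each of the seven graphs has at least C + 1 non-simplicial
      vertices, so being connected it cannot be free of the family.\<close>
    have "\<H> \<le>\<^sub>f\<^sub>a\<^sub>m unavoidable (C + 3)"
      unfolding family_le_def
    proof
      fix H assume H: "H \<in> unavoidable (C + 3)"
      have "\<not> card {v \<in> pverts H. nonsimplicial H v} \<le> C"
        using card_nonsimplicial_unavoidable[OF H] by simp
      then have "\<not> family_free \<H> H"
        using C pair_graph_unavoidable[OF H] connected_unavoidable[OF _ H] by auto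
      then show "\<exists>H1\<in>\<H>. H1 \<le>\<^sub>i\<^sub>n\<^sub>d H" by (simp add: family_free_def)
    qed
    then show "\<exists>n>0. \<H> \<le>\<^sub>f\<^sub>a\<^sub>m unavoidable n" by (intro exI[of _ "C + 3"]) simp
  next
    assume "\<exists>n>0. \<H> \<le>\<^sub>f\<^sub>a\<^sub>m unavoidable n"
    then obtain n where "n > 0" and n: "\<H> \<le>\<^sub>f\<^sub>a\<^sub>m unavoidable n" by blast
    obtain C :: nat where C: "\<forall>G :: nat pair_pre_digraph. pair_graph G \<longrightarrow>
      Digraph_Component.connected (with_proj G) \<longrightarrow>
      C < card {v \<in> pverts G. nonsimplicial G v} \<longrightarrow> contains_unavoidable n G"
      using many_nonsimplicial[OF \<open>n > 0\<close>] ..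
    show "\<exists>C::nat. \<forall>G::nat pair_pre_digraph.
      pair_graph G \<and> Digraph_Component.connected (with_proj G) \<and> family_free \<H> G \<longrightarrow>
      card {v \<in> pverts G. \<alpha> G (neighbourhood G v) \<ge> 2} \<le> C"
    proof (intro exI[of _ C] allI impI, elim conjE)
      fix G :: "nat pair_pre_digraph"
      assume G: "pair_graph G" and conn: "Digraph_Component.connected (with_proj G)"
        and free: "family_free \<H> G"
      \<comment> \<open>A member of the family lies below each of the seven graphs, so by
        transitivity it would lie below \<open>G\<close>.\<close>
      have "\<not> contains_unavoidable n G"
      proof
        assume "contains_unavoidable n G"
        then obtain H2 where H2: "H2 \<in> unavoidable n" "H2 \<le>\<^sub>i\<^sub>n\<^sub>d G"
          unfolding contains_unavoidable_def by blast
        then obtain H1 where "H1 \<in> \<H>" "H1 \<le>\<^sub>i\<^sub>n\<^sub>d H2" using n unfolding family_le_def by blast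
        then have "H1 \<le>\<^sub>i\<^sub>n\<^sub>d G"
          using assms induced_le_trans pair_graph_unavoidable[OF H2(1)] G H2(2) by blast
        then show False using free \<open>H1 \<in> \<H>\<close> unfolding family_free_def by blast
      qed
      then show "card {v \<in> pverts G. \<alpha> G (neighbourhood G v) \<ge> 2} \<le> C"
        using C G conn unfolding card_eq[OF G] by (meson not_le)
    qed
  qed
qed

end
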